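(* For $\nu\in\mathbb{N}_0^d$ such that $2|\nu|<\gamma-|\sigma|-\beta-d-1$, the polynomials $$R_\nu(x;\sigma,\beta,\gamma)=\prod_{j=1}^d(\alpha_{2,j}+1)_{\nu_j}R_{\nu_j}(x_j;\sigma_j,\alpha_{2,j},\alpha_{3,j}),$$ where $$\alpha_{2,j}=\beta+|\nu^{j+1}|+|X_{j-1}|,\qquad \alpha_{3,j}=\gamma-|\nu^{j+1}|-|\sigma^{j+1}|-(d-j)+|X_{j-1}|,$$ satisfy the difference equation $DR_\nu=\lambda_{|\nu|}R_\nu$, where $\lambda_n=n(-n+\gamma-\beta-|\sigma|-d)$ and $$D=-\sum_{1\le i,j\le d}x_j\big[\sigma_i+1+x_i+\delta_{i,j}(\gamma-|\sigma|-d)\big]\triangle_i\nabla_j+\sum_{i=1}^d\big[x_i(\gamma-\beta-|\sigma|-d-1)-(1+\beta)(1+\sigma_i)\big]\triangle_i,$$ and, for $\nu,\mu\in\mathbb{N}_0^d$ with $2|\nu|<\gamma-|\sigma|-\beta-d-1$ and $2|\mu|<\gamma-|\sigma|-\beta-d-1$, the orthogonality relation $$\sum_{x\in\mathbb{N}_0^d}R_\nu(x;\sigma,\beta,\gamma)R_\mu(x;\sigma,\beta,\gamma)\prod_{i=1}^d\frac{(\sigma_i+1)_{x_i}}{x_i!}\,\frac{(\beta+1)_{|x|}}{(\gamma+1)_{|x|}}=A_\nu\delta_{\nu,\mu},$$ where $$A_\nu=\frac{(1+\beta)_{|\nu|}\Gamma(1+\gamma)\Gamma(\gamma-\beta-|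\sigma|-2|\nu|-d)}{\Gamma(\gamma-|\sigma|-|\nu|+1-d)\Gamma(\gamma-\beta)}\prod_{j=1}^d\frac{\nu_j!\,(\alpha_{3,j}-\alpha_{2,j}-\nu_j)_{\nu_j}(\alpha_{3,j-1}-\alpha_{2,j-1}+1)_{\nu_j}}{(1+\sigma_j)_{\nu_j}}.$$
   Context: $d>1$; $\triangle_if(x)=f(x+e_i)-f(x)$, $\nabla_if(x)=f(x)-f(x-e_i)$; $(y)_k=y(y+1)\cdots(y+k-1)$, $(y)_0=1$. For a vector $y\in\mathbb{R}^k$, $|y|=\sum_{i=1}^ky_i$ (no absolute values). For $y=(y_1,\dots,y_d)$: $y^j=(y_j,\dots,y_d)$ and $Y_j=(y_1,\dots,y_j)$, with $y^{d+1}=0$, $Y_0=0$; thus $|\nu^{j+1}|=\nu_{j+1}+\dots+\nu_d$, $|\sigma^{j+1}|=\sigma_{j+1}+\dots+\sigma_d$, $|X_{j-1}|=x_1+\dots+x_{j-1}$. Note $\alpha_{3,j}-\alpha_{2,j}=\gamma-\beta-2|\nu^{j+1}|-|\sigma^{j+1}|-(d-j)$ does not depend on $x$; this formula also defines $\alpha_{3,0}-\alpha_{2,0}$ (take $j=0$). One-variable polynomials: $$R_n(x;\alpha_1,\alpha_2,\alpha_3)=\sum_{k=0}^n\frac{(-n)_k(n-\alpha_3+\alpha_1+\alpha_2+1)_k(-x)_k}{(\alpha_1+1)_k(\alpha_2+1)_k\,k!}.$$ Parameters: $\sigma=(\sigma_1,\dots,\sigma_d)\in\mathbb{R}^d$ with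 $\sigma_i>-1$ for all $i$, and real $\beta,\gamma$ such that the weight is positive on $\mathbb{N}_0^d$, i.e. $(k+\beta)/(k+\gamma)>0$ for all integers $k\ge1$. *)

theory Defs
  imports "HOL-Analysis.Analysis"
begin

text \<open>
  Vectors are functions on \<open>nat\<close> whose components are those with index in \<open>{1..d}\<close>;
  other arguments are never inspected.  \<open>tail_sum d y j\<close> is \<open>y\<^sub>j + \<dots> + y\<^sub>d\<close>, which is \<open>0\<close> for
  \<open>j = d + 1\<close>, and \<open>head_sum y j\<close> is \<open>y\<^sub>1 + \<dots> + y\<^sub>j\<close>, which is \<open>0\<close> for \<open>j = 0\<close>.
\<close>

definition tail_sum :: "nat \<Rightarrow> (nat \<Rightarrow> 'a::comm_monoid_add) \<Rightarrow> nat \<Rightarrow> 'a" where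
  "tail_sum d y j = (\<Sum>i=j..d. y i)"

definition head_sum :: "(nat \<Rightarrow> 'a::comm_monoid_add) \<Rightarrow> nat \<Rightarrow> 'a" where
  "head_sum y j = (\<Sum>i=1..j. y i)"

definition vec_sum :: "nat \<Rightarrow> (nat \<Rightarrow> 'a::comm_monoid_add) \<Rightarrow> 'a" where
  "vec_sum d y = (\<Sum>i=1..d. y i)"

text \<open>The extensional function space makes equality of multi-indices componentwise equality.\<close>

definition multi_indices :: "nat \<Rightarrow> (nat \<Rightarrow> nat) set" where
  "multi_indices d = {1..d} \<rightarrow>\<^sub>E UNIV"

definition real_vec :: "(nat \<Rightarrow> nat) \<Rightarrow> nat \<Rightarrow> real" where
  "real_vec x = (\<lambda>i. real (x i))"

definition is_polynomial :: "nat \<Rightarrow> ((nat \<Rightarrow> real) \<Rightarrow> real) \<Rightarrow> bool" where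
  "is_polynomial d f \<longleftrightarrow> (\<exists>(M :: (nat \<Rightarrow> nat) set) c. finite M \<and>
     (\<forall>x. f x = (\<Sum>m\<in>M. c m * (\<Prod>i=1..d. x i ^ m i))))"

definition forward_diff :: "nat \<Rightarrow> ((nat \<Rightarrow> real) \<Rightarrow> real) \<Rightarrow> (nat \<Rightarrow> real) \<Rightarrow> real" where
  "forward_diff i f x = f (x(i := x i + 1)) - f x"

definition backward_diff :: "nat \<Rightarrow> ((nat \<Rightarrow> real) \<Rightarrow> real) \<Rightarrow> (nat \<Rightarrow> real) \<Rightarrow> real" where
  "backward_diff i f x = f x - f (x(i := x i - 1))"

definition R_uni :: "nat \<Rightarrow> real \<Rightarrow> real \<Rightarrow> real \<Rightarrow> real \<Rightarrow> real" where
  "R_uni n x a1 a2 a3 =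
     (\<Sum>k=0..n. pochhammer (- real n) k * pochhammer (real n - a3 + a1 + a2 + 1) k * pochhammer (- x) k
        / (pochhammer (a1 + 1) k * pochhammer (a2 + 1) k * fact k))"

text \<open>
  \<open>(a2 + 1)\<^sub>n R\<^sub>n(x; a1, a2, a3)\<close> with the quotient \<open>(a2 + 1)\<^sub>n / (a2 + 1)\<^sub>k\<close> cancelled to
  \<open>(a2 + 1 + k)\<^sub>n\<^sub>-\<^sub>k\<close>.  In the multivariate polynomials \<open>a2\<close> depends on \<open>x\<close>, so on real arguments
  the uncancelled expression meets zero denominators at the removable singularities
  \<open>(a2 + 1)\<^sub>n = 0\<close>; elsewhere the two agree.
\<close>

definition R_uni_scaled :: "nat \<Rightarrow> real \<Rightarrow> real \<Rightarrow> real \<Rightarrow> real \<Rightarrow> real" where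
  "R_uni_scaled n x a1 a2 a3 =
     (\<Sum>k=0..n. pochhammer (- real n) k * pochhammer (real n - a3 + a1 + a2 + 1) k * pochhammer (- x) k
        * pochhammer (a2 + 1 + real k) (n - k) / (pochhammer (a1 + 1) k * fact k))"

lemma R_uni_scaled_eq:
  assumes "pochhammer (a2 + 1) n \<noteq> 0"
  shows "R_uni_scaled n x a1 a2 a3 = pochhammer (a2 + 1) n * R_uni n x a1 a2 a3"
proof -
  have "pochhammer (a2 + 1) n = pochhammer (a2 + 1) k * pochhammer (a2 + 1 + real k) (n - k)"
    if "k \<le> n" for k
    using that by (rule pochhammer_product)
  then show ?thesis
    unfolding R_uni_scaled_def R_uni_def sum_distrib_left
    using assms by (intro sum.cong) (auto simp: field_simps)
qed

definition alpha2 :: "nat \<Rightarrow> real \<Rightarrow> (nat \<Rightarrow> nat) \<Rightarrow> (nat \<Rightarrow> real) \<Rightarrow> nat \<Rightarrow> real" where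
  "alpha2 d \<beta> \<nu> x j = \<beta> + real (tail_sum d \<nu> (j + 1)) + head_sum x (j - 1)"

definition alpha3 ::
    "nat \<Rightarrow> (nat \<Rightarrow> real) \<Rightarrow> real \<Rightarrow> (nat \<Rightarrow> nat) \<Rightarrow> (nat \<Rightarrow> real) \<Rightarrow> nat \<Rightarrow> real" where
  "alpha3 d \<sigma> \<gamma> \<nu> x j = \<gamma> - real (tail_sum d \<nu> (j + 1)) - tail_sum d \<sigma> (j + 1) - (real d - real j)
     + head_sum x (j - 1)"

text \<open>\<open>\<alpha>\<^sub>3\<^sub>,\<^sub>j - \<alpha>\<^sub>2\<^sub>,\<^sub>j\<close>, which does not depend on \<open>x\<close>; this formula is also used for \<open>j = 0\<close>.\<close>

definition alpha32 :: "nat \<Rightarrow> (nat \<Rightarrow> real) \<Rightarrow> real \<Rightarrow> real \<Rightarrow> (nat \<Rightarrow> nat) \<Rightarrow> nat \<Rightarrow> real" where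
  "alpha32 d \<sigma> \<beta> \<gamma> \<nu> j =
     \<gamma> - \<beta> - 2 * real (tail_sum d \<nu> (j + 1)) - tail_sum d \<sigma> (j + 1) - (real d - real j)"

lemma alpha32_eq: "alpha32 d \<sigma> \<beta> \<gamma> \<nu> j = alpha3 d \<sigma> \<gamma> \<nu> x j - alpha2 d \<beta> \<nu> x j"
  by (simp add: alpha32_def alpha3_def alpha2_def)

definition R_multi ::
    "nat \<Rightarrow> (nat \<Rightarrow> real) \<Rightarrow> real \<Rightarrow> real \<Rightarrow> (nat \<Rightarrow> nat) \<Rightarrow> (nat \<Rightarrow> real) \<Rightarrow> real" where
  "R_multi d \<sigma> \<beta> \<gamma> \<nu> x =
     (\<Prod>j=1..d. R_uni_scaled (\<nu> j) (x j) (\<sigma> j) (alpha2 d \<beta> \<nu> x j) (alpha3 d \<sigma> \<gamma> \<nu> x j))"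

definition D_op ::
    "nat \<Rightarrow> (nat \<Rightarrow> real) \<Rightarrow> real \<Rightarrow> real \<Rightarrow> ((nat \<Rightarrow> real) \<Rightarrow> real) \<Rightarrow> (nat \<Rightarrow> real) \<Rightarrow> real" where
  "D_op d \<sigma> \<beta> \<gamma> f x =
     - (\<Sum>i=1..d. \<Sum>j=1..d.
          x j * (\<sigma> i + 1 + x i + (if i = j then \<gamma> - vec_sum d \<sigma> - real d else 0))
            * forward_diff i (backward_diff j f) x)
     + (\<Sum>i=1..d.
          (x i * (\<gamma> - \<beta> - vec_sum d \<sigma> - real d - 1) - (1 + \<beta>) * (1 + \<sigma> i)) * forward_diff i f x)"

definition eigval :: "nat \<Rightarrow> (nat \<Rightarrow> real) \<Rightarrow> real \<Rightarrow> real \<Rightarrow> nat \<Rightarrow> real" where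
  "eigval d \<sigma> \<beta> \<gamma> n = real n * (- real n + \<gamma> - \<beta> - vec_sum d \<sigma> - real d)"

definition weight :: "nat \<Rightarrow> (nat \<Rightarrow> real) \<Rightarrow> real \<Rightarrow> real \<Rightarrow> (nat \<Rightarrow> nat) \<Rightarrow> real" where
  "weight d \<sigma> \<beta> \<gamma> x =
     (\<Prod>i=1..d. pochhammer (\<sigma> i + 1) (x i) / fact (x i))
     * (pochhammer (\<beta> + 1) (vec_sum d x) / pochhammer (\<gamma> + 1) (vec_sum d x))"

definition sq_norm :: "nat \<Rightarrow> (nat \<Rightarrow> real) \<Rightarrow> real \<Rightarrow> real \<Rightarrow> (nat \<Rightarrow> nat) \<Rightarrow> real" where
  "sq_norm d \<sigma> \<beta> \<gamma> \<nu> =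
     pochhammer (1 + \<beta>) (vec_sum d \<nu>) * Gamma (1 + \<gamma>)
       * Gamma (\<gamma> - \<beta> - vec_sum d \<sigma> - 2 * real (vec_sum d \<nu>) - real d)
     / (Gamma (\<gamma> - vec_sum d \<sigma> - real (vec_sum d \<nu>) + 1 - real d) * Gamma (\<gamma> - \<beta>))
     * (\<Prod>j=1..d. fact (\<nu> j) * pochhammer (alpha32 d \<sigma> \<beta> \<gamma> \<nu> j - real (\<nu> j)) (\<nu> j)
          * pochhammer (alpha32 d \<sigma> \<beta> \<gamma> \<nu> (j - 1) + 1) (\<nu> j)
          / pochhammer (1 + \<sigma> j) (\<nu> j))"

definition admissible :: "nat \<Rightarrow> (nat \<Rightarrow> real) \<Rightarrow> real \<Rightarrow> real \<Rightarrow> (nat \<Rightarrow> nat) \<Rightarrow> bool" where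
  "admissible d \<sigma> \<beta> \<gamma> \<nu> \<longleftrightarrow>
     \<nu> \<in> multi_indices d \<and> 2 * real (vec_sum d \<nu>) < \<gamma> - vec_sum d \<sigma> - \<beta> - real d - 1"

end

theory Submission
  imports Defs
begin

text \<open>
  Everything is proved by induction on the number of variables, splitting off the last one.  In
  \<open>R\<^sub>\<nu>(x; \<sigma>, \<beta>, \<gamma>)\<close> the factor with \<open>j = d\<close> depends only on \<open>x\<^sub>d\<close> and on \<open>X = x\<^sub>1 + \<dots> + x\<^sub>d\<^sub>-\<^sub>1\<close>; with
  \<open>n = \<nu>\<^sub>d\<close>, the product of the other factors is the polynomial of the same family in \<open>d - 1\<close>
  variables with parameters \<open>\<beta>' = \<beta> + n\<close> and \<open>\<gamma>' = \<gamma> - \<sigma>\<^sub>d - n - 1\<close> (\<open>R_multi_Suc\<close>).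

  Orthogonality.  For fixed \<open>x\<^sub>1, \<dots>, x\<^sub>d\<^sub>-\<^sub>1\<close> the weight is, as a function of \<open>x\<^sub>d\<close>, the one-variable
  weight with parameters \<open>\<sigma>\<^sub>d\<close>, \<open>\<beta> + X\<close>, \<open>\<gamma> + X\<close>.  The sum over \<open>x\<^sub>d\<close> therefore gives a Kronecker delta
  times the one-variable norm, and this norm times the weight in \<open>d - 1\<close> variables is a constant
  multiple of the weight with parameters \<open>\<beta>'\<close> and \<open>\<gamma>'\<close> (\<open>weight_mult_uni_norm\<close>).  The squares are
  treated first, where iterated summation needs only nonnegativity; they dominate the mixed
  products.  In one variable (\<open>R_uni_scaled_orthogonal\<close>) the sums of \<open>(-y)\<^sub>k (\<sigma> + 1 + y)\<^sub>l\<close> against the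
  weight are evaluated by Gauss's summation theorem.  The sum of \<open>R\<^sub>n(y) (\<sigma> + 1 + y)\<^sub>l\<close> then reduces
  to an alternating binomial sum of a polynomial of degree less than \<open>n\<close> if \<open>l < n\<close>, and of a
  polynomial divided by a linear function if \<open>l = n\<close>.

  Difference equation.  In terms of shifts, \<open>D\<close> is a combination of
  \<open>\<Sum> x\<^sub>j (\<sigma>\<^sub>i + 1 + x\<^sub>i) f(x + e\<^sub>i - e\<^sub>j)\<close>, \<open>\<Sum> (\<sigma>\<^sub>i + 1 + x\<^sub>i) f(x + e\<^sub>i)\<close>, \<open>\<Sum> x\<^sub>j f(x - e\<^sub>j)\<close> and \<open>f(x)\<close>,
  with coefficients that depend on \<open>x\<close> only through \<open>|x|\<close> (\<open>D_op_eq_ladder\<close>).  On a product of a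
  function \<open>g(X, x\<^sub>d)\<close> and a function of \<open>x\<^sub>1, \<dots>, x\<^sub>d\<^sub>-\<^sub>1\<close> these operators act through their analogues in
  \<open>d - 1\<close> variables.  Two contiguous relations and the difference equation in one variable turn the
  result into the operator \<open>D\<close> in \<open>d - 1\<close> variables with parameters \<open>\<beta>'\<close> and \<open>\<gamma>'\<close>.
\<close>

section \<open>Gauss summation and alternating binomial sums\<close>

text \<open>
  Since \<open>(b)\<^sub>n / (c)\<^sub>n = B(b + n, c - b) / B(b, c - b)\<close>, the series is, up to the factor
  \<open>1 / B(b, c - b)\<close>, the integral over \<open>[0, 1]\<close> of \<open>t\<^sup>b\<^sup>-\<^sup>1 (1 - t)\<^sup>c\<^sup>-\<^sup>b\<^sup>-\<^sup>1\<close> times the binomial series of \<open>(1 - t)\<^sup>-\<^sup>a\<close>.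
\<close>

lemma gauss_hypergeometric_sum:
  fixes a b c :: real
  assumes a: "a > 0" and b: "b > 0" and c: "c > a + b"
  shows "((\<lambda>n. pochhammer a n * pochhammer b n / (fact n * pochhammer c n)) has_sum
           Gamma c * Gamma (c - a - b) / (Gamma (c - a) * Gamma (c - b))) UNIV"
proof -
  define u where "u n t = pochhammer a n / fact n * (t powr (b + real n - 1) * (1 - t) powr (c - b - 1))"
    for n :: nat and t :: real
  define g where "g t = t powr (b - 1) * (1 - t) powr (c - a - b - 1)" for t :: real
  have u_int: "(u n has_integral pochhammer a n / fact n * Beta (b + real n) (c - b)) {0<..<1}" for n
    unfolding u_def
    using has_integral_Beta_real[of "b + real n" "c - b"] a b c
    by (intro has_integral_mult_right) (auto simp: has_integral_Icc_iff_Ioo)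
  have g_int: "(g has_integral Beta b (c - a - b)) {0<..<1}"
    unfolding g_def using has_integral_Beta_real[of b "c - a - b"] a b c
    by (simp add: has_integral_Icc_iff_Ioo)
  have u_nonneg: "u n t \<ge> 0" if "t \<in> {0<..<1}" for n t
    unfolding u_def using a that by (intro mult_nonneg_nonneg divide_nonneg_nonneg pochhammer_nonneg) auto
  have u_sums: "(\<lambda>n. u n t) sums g t" if t: "t \<in> {0<..<1}" for t
  proof -
    have "(\<lambda>n. ((-a) gchoose n) * (-t) ^ n) sums (1 + - t) powr (-a)"
      using t by (intro gen_binomial_real) auto
    also have "(\<lambda>n. ((-a) gchoose n) * (-t) ^ n) = (\<lambda>n. pochhammer a n / fact n * t ^ n)"
      by (intro ext) (simp add: gbinomial_pochhammer flip: power_mult_distrib)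
    finally have "(\<lambda>n. t powr (b - 1) * (1 - t) powr (c - b - 1) * (pochhammer a n / fact n * t ^ n)) sums
        (t powr (b - 1) * (1 - t) powr (c - b - 1) * (1 + - t) powr (-a))"
      by (intro sums_mult)
    also have "(\<lambda>n. t powr (b - 1) * (1 - t) powr (c - b - 1) * (pochhammer a n / fact n * t ^ n)) = (\<lambda>n. u n t)"
    proof
      fix n
      have "t powr (b + real n - 1) = t powr (b - 1) * t ^ n"
        using t by (simp add: powr_add powr_diff powr_realpow)
      then show "t powr (b - 1) * (1 - t) powr (c - b - 1) * (pochhammer a n / fact n * t ^ n) = u n t"
        by (simp add: u_def)
    qed
    also have "t powr (b - 1) * (1 - t) powr (c - b - 1) * (1 + - t) powr (-a) = g t"
    proof -
      have "(1 - t) powr (c - b - 1) * (1 - t) powr (- a) = (1 - t) powr (c - a - b - 1)"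
        by (simp add: algebra_simps flip: powr_add)
      then show ?thesis by (simp add: g_def)
    qed
    finally show ?thesis .
  qed
  have part_int: "((\<lambda>t. \<Sum>n<k. u n t) has_integral
      (\<Sum>n<k. pochhammer a n / fact n * Beta (b + real n) (c - b))) {0<..<1}" for k
    by (intro has_integral_sum u_int) auto
  have part_le: "(\<Sum>n<k. u n t) \<le> g t" if t: "t \<in> {0<..<1}" for k t
    using u_sums[OF t] u_nonneg[OF t] by (metis sum_le_suminf sums_iff finite_lessThan)
  \<comment> \<open>The terms are nonnegative, so sum and integral may be exchanged by monotone convergence.\<close>
  have "g integrable_on {0<..<1} \<and>
      (\<lambda>k. integral {0<..<1} (\<lambda>t. \<Sum>n<k. u n t)) \<longlonglongrightarrow> integral {0<..<1} g"
  proof (rule monotone_convergence_increasing)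
    show "(\<lambda>t. \<Sum>n<k. u n t) integrable_on {0<..<1}" for k
      using part_int by blast
    show "(\<Sum>n<k. u n t) \<le> (\<Sum>n<Suc k. u n t)" if "t \<in> {0<..<1}" for k t
      using u_nonneg[OF that] by simp
    show "(\<lambda>k. \<Sum>n<k. u n t) \<longlonglongrightarrow> g t" if "t \<in> {0<..<1}" for t
      using u_sums[OF that] by (simp add: sums_def)
    show "bounded (range (\<lambda>k. integral {0<..<1} (\<lambda>t. \<Sum>n<k. u n t)))"
    proof (rule boundedI)
      fix z assume "z \<in> range (\<lambda>k. integral {0<..<1} (\<lambda>t. \<Sum>n<k. u n t))"
      then obtain k where z: "z = integral {0<..<1} (\<lambda>t. \<Sum>n<k. u n t)" by blast
      have "z \<le> Beta b (c - a - b)"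
        unfolding z using part_int[of k] g_int part_le
        by (metis (no_types, lifting) has_integral_le integral_unique)
      moreover have "z \<ge> 0" unfolding z
        using part_int[of k] u_nonneg by (intro integral_nonneg sum_nonneg) blast+
      ultimately show "norm z \<le> Beta b (c - a - b)" by simp
    qed
  qed
  then have "(\<lambda>k. \<Sum>n<k. pochhammer a n / fact n * Beta (b + real n) (c - b)) \<longlonglongrightarrow> Beta b (c - a - b)"
    using integral_unique[OF part_int] integral_unique[OF g_int] by simp
  then have "(\<lambda>n. pochhammer a n / fact n * Beta (b + real n) (c - b)) sums Beta b (c - a - b)"
    by (simp add: sums_def)
  then have "(\<lambda>n. Gamma c / (Gamma b * Gamma (c - b)) * (pochhammer a n / fact n * Beta (b + real n) (c - b))) sums
      (Gamma c / (Gamma b * Gamma (c - b)) * Beta b (c - a - b))"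
    by (rule sums_mult)
  moreover have "Gamma c / (Gamma b * Gamma (c - b)) * (pochhammer a n / fact n * Beta (b + real n) (c - b)) =
      pochhammer a n * pochhammer b n / (fact n * pochhammer c n)" for n
  proof -
    have "Gamma b > 0" "Gamma (c - b) > 0" "Gamma c > 0" "Gamma (c + real n) > 0"
      using a b c by (auto intro!: Gamma_real_pos)
    moreover have "b \<notin> \<int>\<^sub>\<le>\<^sub>0" "c \<notin> \<int>\<^sub>\<le>\<^sub>0"
      using a b c by (auto dest: nonpos_Ints_nonpos)
    ultimately show ?thesis
      by (simp add: Beta_def pochhammer_Gamma algebra_simps)
  qed
  moreover have "Gamma c / (Gamma b * Gamma (c - b)) * Beta b (c - a - b) =
      Gamma c * Gamma (c - a - b) / (Gamma (c - a) * Gamma (c - b))"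
  proof -
    have "Gamma b > 0" using b by (rule Gamma_real_pos)
    then show ?thesis by (simp add: Beta_def algebra_simps)
  qed
  ultimately have "(\<lambda>n. pochhammer a n * pochhammer b n / (fact n * pochhammer c n)) sums
      (Gamma c * Gamma (c - a - b) / (Gamma (c - a) * Gamma (c - b)))"
    by simp
  then show ?thesis
    using a b c
    by (intro sums_nonneg_imp_has_sum divide_nonneg_nonneg mult_nonneg_nonneg pochhammer_nonneg) auto
qed

text \<open>The \<open>n\<close>-th difference of a polynomial of degree less than \<open>n\<close> vanishes.\<close>

lemma alternating_binomial_sum_poly:
  fixes p :: "real poly"
  assumes "degree p < n"
  shows "(\<Sum>k\<le>n. (-1) ^ k * real (n choose k) * poly p (real k)) = 0"
  using assms
proof (induction n arbitrary: p)
  case (Suc n p)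
  obtain a q where p: "p = pCons a q" by (cases p)
  define q' where "q' = q \<circ>\<^sub>p [:1, 1:]"
  have choose: "real (Suc n choose Suc k) * real (Suc k) = real (Suc n) * real (n choose k)" for k
    using Suc_times_binomial_eq[of n k] by (metis of_nat_mult mult.commute)
  have "(\<Sum>k\<le>Suc n. (-1) ^ k * real (Suc n choose k) * poly p (real k)) =
      a * (\<Sum>k\<le>Suc n. (-1) ^ k * real (Suc n choose k)) +
      (\<Sum>k\<le>Suc n. (-1) ^ k * real (Suc n choose k) * real k * poly q (real k))"
    by (simp only: p poly_pCons sum_distrib_left flip: sum.distrib) (simp add: algebra_simps)
  also have "(\<Sum>k\<le>Suc n. (-1) ^ k * real (Suc n choose k)) = 0"
    by (rule choose_alternating_sum) simp
  also have "(\<Sum>k\<le>Suc n. (-1) ^ k * real (Suc n choose k) * real k * poly q (real k)) =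
      (\<Sum>k\<le>n. (-1) ^ Suc k * (real (Suc n choose Suc k) * real (Suc k)) * poly q (real (Suc k)))"
    by (subst sum.atMost_Suc_shift) (simp add: mult.assoc)
  also have "\<dots> = - real (Suc n) * (\<Sum>k\<le>n. (-1) ^ k * real (n choose k) * poly q' (real k))"
    unfolding choose q'_def sum_distrib_left
    by (intro sum.cong) (auto simp: poly_pcompose algebra_simps)
  also have "\<dots> = 0"
  proof (cases "q = 0")
    case False
    then have "degree q' < n"
      using Suc.prems by (simp add: q'_def p degree_pcompose)
    then show ?thesis by (simp add: Suc.IH)
  qed (simp add: q'_def)
  finally show ?case by simp
qed simp

text \<open>Up to a constant factor, the partial fraction expansion of \<open>1 / (t (t - 1) \<dots> (t - n))\<close>.\<close>

lemma alternating_binomial_sum_reciprocal: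
  fixes t :: real
  assumes "\<And>k. k \<le> n \<Longrightarrow> t \<noteq> real k"
  shows "(\<Sum>k\<le>n. (-1) ^ k * real (n choose k) / (t - real k)) =
           (-1) ^ n * fact n / pochhammer (t - real n) (Suc n)"
  using assms
proof (induction n arbitrary: t)
  case (Suc n t)
  have t: "t \<noteq> real k" if "k \<le> Suc n" for k using Suc.prems that by blast
  have "(\<Sum>k\<le>Suc n. (-1) ^ k * real (Suc n choose k) / (t - real k)) =
      1 / t + (\<Sum>k\<le>n. (-1) ^ Suc k * (real (n choose Suc k) + real (n choose k)) / (t - real (Suc k)))"
    by (subst sum.atMost_Suc_shift) (simp add: add.commute)
  also have "\<dots> = (1 / t + (\<Sum>k\<le>n. (-1) ^ Suc k * real (n choose Suc k) / (t - real (Suc k))))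
      - (\<Sum>k\<le>n. (-1) ^ k * real (n choose k) / ((t - 1) - real k))"
    by (simp add: sum_subtractf algebra_simps add_divide_distrib diff_divide_distrib flip: sum.distrib sum_negf)
  also have "1 / t + (\<Sum>k\<le>n. (-1) ^ Suc k * real (n choose Suc k) / (t - real (Suc k))) =
      (\<Sum>k\<le>Suc n. (-1) ^ k * real (n choose k) / (t - real k))"
    unfolding sum.atMost_Suc_shift by simp
  also have "\<dots> = (\<Sum>k\<le>n. (-1) ^ k * real (n choose k) / (t - real k))" by simp
  also have "\<dots> = (-1) ^ n * fact n / pochhammer (t - real n) (Suc n)"
    using t by (intro Suc.IH) auto
  also have "(\<Sum>k\<le>n. (-1) ^ k * real (n choose k) / ((t - 1) - real k)) =
      (-1) ^ n * fact n / pochhammer (t - 1 - real n) (Suc n)"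
  proof (intro Suc.IH)
    show "t - 1 \<noteq> real k" if "k \<le> n" for k using t[of "Suc k"] that by auto
  qed
  also have "(-1) ^ n * fact n / pochhammer (t - real n) (Suc n)
      - (-1) ^ n * fact n / pochhammer (t - 1 - real n) (Suc n) =
      (-1) ^ Suc n * fact (Suc n) / pochhammer (t - real (Suc n)) (Suc (Suc n))"
  proof -
    define P where "P = pochhammer (t - real n) n"
    have "P \<noteq> 0"
    proof
      assume "P = 0"
      then obtain i where "i < n" "t - real n = - real i" unfolding P_def pochhammer_eq_0_iff by blast
      then have "t = real (n - i)" by simp
      then show False using t[of "n - i"] by simp
    qed
    moreover have "t \<noteq> 0" using t[of 0] by simp
    moreover have "t - real (Suc n) \<noteq> 0" using t[of "Suc n"] by simp
    moreover have 1: "pochhammer (t - real n) (Suc n) = P * t"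
      by (simp add: pochhammer_Suc P_def)
    moreover have 2: "pochhammer (t - 1 - real n) (Suc n) = (t - real (Suc n)) * P"
      by (simp add: pochhammer_rec P_def algebra_simps)
    moreover have 3: "pochhammer (t - real (Suc n)) (Suc (Suc n)) = (t - real (Suc n)) * (P * t)"
      by (subst pochhammer_rec) (simp add: P_def pochhammer_Suc algebra_simps)
    ultimately show ?thesis
      unfolding 1 2 3 by (simp add: divide_simps) (simp add: algebra_simps)
  qed
  finally show ?case .
qed simp

lemma poly_pochhammer: "poly (pochhammer p n) x = pochhammer (poly p x) n"
  for p :: "'a::comm_ring_1 poly"
  by (induction n) (simp_all add: pochhammer_Suc)

lemma degree_pochhammer_le:
  fixes p :: "'a::comm_ring_1 poly"
  assumes "degree p \<le> 1"
  shows "degree (pochhammer p n) \<le> n"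
proof (induction n)
  case (Suc n)
  have "degree (p + of_nat n) \<le> 1"
    using assms by (intro degree_add_le) auto
  then show ?case
    using Suc degree_mult_le[of "pochhammer p n" "p + of_nat n"] by (simp add: pochhammer_Suc)
qed simp

text \<open>
  Division of \<open>(a + X)\<^sub>n\<close> by \<open>X - t\<close> leaves the remainder \<open>(a + t)\<^sub>n\<close> and a quotient of degree
  less than \<open>n\<close>, which contributes nothing to the alternating sum.
\<close>

lemma alternating_binomial_sum_pochhammer_quotient:
  fixes a t :: real
  assumes "\<And>k. k \<le> n \<Longrightarrow> t \<noteq> real k"
  shows "(\<Sum>k\<le>n. (-1) ^ k * real (n choose k) * pochhammer (a + real k) n / (t - real k)) =
           (-1) ^ n * fact n * pochhammer (a + t) n / pochhammer (t - real n) (Suc n)"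
proof -
  define p where "p = pochhammer [:a, 1:] n"
  define q where "q = synthetic_div p t"
  have p: "poly p x = pochhammer (a + x) n" for x by (simp add: p_def poly_pochhammer)
  have "degree p \<le> n" unfolding p_def by (intro degree_pochhammer_le) simp
  have pq: "poly p x = (x - t) * poly q x + poly p t" for x
    using arg_cong[OF synthetic_div_correct'[of t p], of "\<lambda>r. poly r x"] unfolding q_def
    by (simp add: algebra_simps)
  have q0: "(\<Sum>k\<le>n. (-1) ^ k * real (n choose k) * poly q (real k)) = 0"
  proof (cases "q = 0")
    case False
    then have "degree p > 0" unfolding q_def synthetic_div_eq_0_iff by simp
    then have "degree q < n" using \<open>degree p \<le> n\<close> by (simp add: q_def degree_synthetic_div)
    then show ?thesis by (rule alternating_binomial_sum_poly)
  qed simp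
  have "(\<Sum>k\<le>n. (-1) ^ k * real (n choose k) * pochhammer (a + real k) n / (t - real k)) =
      (\<Sum>k\<le>n. poly p t * ((-1) ^ k * real (n choose k) / (t - real k))
         - (-1) ^ k * real (n choose k) * poly q (real k))"
  proof (intro sum.cong refl)
    fix k assume "k \<in> {..n}"
    then have "t - real k \<noteq> 0" using assms[of k] by simp
    then show "(-1) ^ k * real (n choose k) * pochhammer (a + real k) n / (t - real k) =
        poly p t * ((-1) ^ k * real (n choose k) / (t - real k)) - (-1) ^ k * real (n choose k) * poly q (real k)"
      by (subst p[symmetric], subst pq) (simp add: field_simps)
  qed
  also have "\<dots> = poly p t * (\<Sum>k\<le>n. (-1) ^ k * real (n choose k) / (t - real k))"
    unfolding sum_subtractf q0 sum_distrib_left by simp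
  also have "(\<Sum>k\<le>n. (-1) ^ k * real (n choose k) / (t - real k)) =
      (-1) ^ n * fact n / pochhammer (t - real n) (Suc n)"
    using assms by (rule alternating_binomial_sum_reciprocal)
  finally show ?thesis by (simp add: p mult_ac)
qed

section \<open>Orthogonality in one variable\<close>

text \<open>The one-variable weight, with \<open>\<sigma>, \<beta>, \<gamma>\<close> in the roles of \<open>\<alpha>\<^sub>1, \<alpha>\<^sub>2, \<alpha>\<^sub>3\<close>.\<close>

definition beta_weight :: "real \<Rightarrow> real \<Rightarrow> real \<Rightarrow> nat \<Rightarrow> real" where
  "beta_weight \<sigma> \<beta> \<gamma> y =
     pochhammer (\<sigma> + 1) y / fact y * (pochhammer (\<beta> + 1) y / pochhammer (\<gamma> + 1) y)"

lemma pochhammer_minus_of_nat: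
  "pochhammer (- real (m + k)) k = (-1) ^ k * fact (m + k) / fact m"
proof -
  have "fact (m + k) = fact m * pochhammer (real m + 1) k"
    unfolding pochhammer_fact by (subst pochhammer_product'[of 1 m k]) (simp add: add.commute)
  then show ?thesis
    by (subst pochhammer_minus) (simp add: algebra_simps)
qed

lemma has_sum_sum:
  fixes f :: "'i \<Rightarrow> 'a \<Rightarrow> 'b::topological_comm_monoid_add"
  assumes "\<And>i. i \<in> I \<Longrightarrow> (f i has_sum s i) A"
  shows "((\<lambda>x. \<Sum>i\<in>I. f i x) has_sum (\<Sum>i\<in>I. s i)) A"
  using assms by (induction I rule: infinite_finite_induct) (auto intro: has_sum_add)

text \<open>
  Multiplication by \<open>(-y)\<^sub>k (\<sigma> + 1 + y)\<^sub>l\<close> shifts the summation index and the parameters of the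
  weight and brings out a constant factor, so each such moment is again a Gauss sum.
\<close>

lemma beta_weight_moment:
  assumes \<sigma>: "\<sigma> > -1" and \<beta>: "\<beta> > -1" and kl: "real k + real l < \<gamma> - \<sigma> - \<beta> - 1"
  shows "((\<lambda>y. pochhammer (- real y) k * pochhammer (\<sigma> + 1 + real y) l * beta_weight \<sigma> \<beta> \<gamma> y) has_sum
     (-1) ^ k * pochhammer (\<sigma> + 1) (l + k) * pochhammer (\<beta> + 1) k * Gamma (\<gamma> + 1)
       * Gamma (\<gamma> - \<sigma> - \<beta> - 1 - real l - real k) / (Gamma (\<gamma> - \<sigma> - real l) * Gamma (\<gamma> - \<beta>))) UNIV"
    (is "(?f has_sum ?S) UNIV")
proof -
  define C where "C = (-1) ^ k * pochhammer (\<sigma> + 1) (k + l) * pochhammer (\<beta> + 1) k / pochhammer (\<gamma> + 1) k"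
  have \<gamma>: "\<gamma> + 1 > 0" using assms by linarith
  have pos: "pochhammer (\<gamma> + 1) k > 0"
    using \<gamma> by (rule pochhammer_pos)
  have "((\<lambda>m. C * (pochhammer (\<sigma> + 1 + real (k + l)) m * pochhammer (\<beta> + 1 + real k) m /
            (fact m * pochhammer (\<gamma> + 1 + real k) m))) has_sum
      C * (Gamma (\<gamma> + 1 + real k) * Gamma (\<gamma> + 1 + real k - (\<sigma> + 1 + real (k + l)) - (\<beta> + 1 + real k)) /
         (Gamma (\<gamma> + 1 + real k - (\<sigma> + 1 + real (k + l))) * Gamma (\<gamma> + 1 + real k - (\<beta> + 1 + real k))))) UNIV"
    using assms by (intro has_sum_cmult_right gauss_hypergeometric_sum) auto
  moreover have "C * (pochhammer (\<sigma> + 1 + real (k + l)) m * pochhammer (\<beta> + 1 + real k) m /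
            (fact m * pochhammer (\<gamma> + 1 + real k) m)) = ?f (m + k)" for m
  proof -
    have "pochhammer (\<sigma> + 1) (k + l) * pochhammer (\<sigma> + 1 + real (k + l)) m =
        pochhammer (\<sigma> + 1) (m + k) * pochhammer (\<sigma> + 1 + real (m + k)) l"
      by (simp only: flip: pochhammer_product') (simp add: ac_simps)
    moreover have "pochhammer x (m + k) = pochhammer x k * pochhammer (x + real k) m" for x
      by (subst pochhammer_product'[symmetric]) (simp add: add.commute)
    note this[of "\<beta> + 1"] this[of "\<gamma> + 1"]
    ultimately show ?thesis
      unfolding C_def beta_weight_def pochhammer_minus_of_nat
      using pos by (simp add: field_simps)
  qed
  moreover have "C * (Gamma (\<gamma> + 1 + real k) * Gamma (\<gamma> + 1 + real k - (\<sigma> + 1 + real (k + l)) - (\<beta> + 1 + real k)) /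
         (Gamma (\<gamma> + 1 + real k - (\<sigma> + 1 + real (k + l))) * Gamma (\<gamma> + 1 + real k - (\<beta> + 1 + real k)))) = ?S"
  proof -
    have "\<gamma> + 1 \<notin> \<int>\<^sub>\<le>\<^sub>0" using \<gamma> by (auto dest: nonpos_Ints_nonpos)
    then have G: "Gamma (\<gamma> + 1 + real k) = pochhammer (\<gamma> + 1) k * Gamma (\<gamma> + 1)"
      using \<gamma> by (simp add: pochhammer_Gamma Gamma_eq_zero_iff)
    have args: "\<gamma> - \<sigma> - real l - (\<beta> + 1 + real k) = \<gamma> - \<sigma> - \<beta> - 1 - real l - real k"
      "\<gamma> + 1 + real k - (\<sigma> + 1 + real (k + l)) = \<gamma> - \<sigma> - real l"
      "\<gamma> + 1 + real k - (\<beta> + 1 + real k) = \<gamma> - \<beta>" by auto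
    show ?thesis
      unfolding args G C_def using pos by (simp add: add.commute[of k l])
  qed
  ultimately have "((\<lambda>m. ?f (m + k)) has_sum ?S) UNIV"
    by simp
  also have "((\<lambda>m. ?f (m + k)) has_sum ?S) UNIV \<longleftrightarrow> (?f has_sum ?S) {k..}"
    by (rule has_sum_reindex_bij_betw, rule bij_betwI[where g = "\<lambda>y. y - k"]) auto
  also have "\<dots> \<longleftrightarrow> (?f has_sum ?S) UNIV"
    by (rule has_sum_cong_neutral) (auto simp: pochhammer_of_nat_eq_0_lemma)
  finally show ?thesis .
qed


text \<open>The coefficient of \<open>(-x)\<^sub>k\<close> in \<open>R_uni_scaled n x \<sigma> \<beta> \<gamma>\<close>.\<close>

definition uni_coeff :: "nat \<Rightarrow> real \<Rightarrow> real \<Rightarrow> real \<Rightarrow> nat \<Rightarrow> real" where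
  "uni_coeff n \<sigma> \<beta> \<gamma> k =
     pochhammer (- real n) k * pochhammer (real n - \<gamma> + \<sigma> + \<beta> + 1) k * pochhammer (\<beta> + 1 + real k) (n - k)
       / (pochhammer (\<sigma> + 1) k * fact k)"

lemma R_uni_scaled_eq_sum_uni_coeff:
  "R_uni_scaled n x \<sigma> \<beta> \<gamma> = (\<Sum>k\<le>n. uni_coeff n \<sigma> \<beta> \<gamma> k * pochhammer (- x) k)"
  unfolding R_uni_scaled_def uni_coeff_def atMost_atLeast0 by (intro sum.cong) auto

lemma pochhammer_minus_eq_binomial: "pochhammer (- real n) k = (-1) ^ k * fact k * real (n choose k)"
proof -
  have "real (n choose k) = (-1) ^ k * pochhammer (- real n) k / fact k"
    by (simp add: binomial_gbinomial gbinomial_pochhammer)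
  then have "(-1) ^ k * fact k * real (n choose k) = ((-1) ^ k * (-1) ^ k) * pochhammer (- real n) k"
    by simp
  also have "(-1) ^ k * (-1) ^ k = (1::real)" by (simp flip: power_add)
  finally show ?thesis by simp
qed

text \<open>
  With \<open>c = \<gamma> - \<sigma> - \<beta> - 1\<close>, the Gamma factor of the \<open>k\<close>-th moment combines with the factor
  \<open>(n - c)\<^sub>k\<close> of the coefficient to \<open>H k\<close>, up to sign and a factor independent of \<open>k\<close>.  This
  \<open>H k\<close> is for \<open>l < n\<close> a polynomial in \<open>k\<close> of degree \<open>n - l - 1\<close>, and has for \<open>l = n\<close> a single
  simple pole.  What remains is an alternating binomial sum of
  \<open>(\<sigma> + 1 + k)\<^sub>l H k\<close>.
\<close>

lemma R_uni_scaled_moment: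
  assumes \<sigma>: "\<sigma> > -1" and \<beta>: "\<beta> > -1" and n: "2 * real n < \<gamma> - \<sigma> - \<beta> - 1" and l: "l \<le> n"
  shows "((\<lambda>y. R_uni_scaled n (real y) \<sigma> \<beta> \<gamma> * pochhammer (\<sigma> + 1 + real y) l * beta_weight \<sigma> \<beta> \<gamma> y) has_sum
     (if l < n then 0 else
       (-1) ^ n * fact n * pochhammer (\<beta> + 1) n * pochhammer (\<gamma> - \<beta> - real n) n * Gamma (\<gamma> + 1)
         * Gamma (\<gamma> - \<sigma> - \<beta> - 1 - 2 * real n) / (Gamma (\<gamma> - \<sigma> - real n) * Gamma (\<gamma> - \<beta>)))) UNIV"
    (is "(?f has_sum ?S) UNIV")
proof -
  define c where "c = \<gamma> - \<sigma> - \<beta> - 1"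
  define K where "K = pochhammer (\<beta> + 1) n * Gamma (\<gamma> + 1) * Gamma (c - real n + 1)
      / (Gamma (\<gamma> - \<sigma> - real l) * Gamma (\<gamma> - \<beta>))"
  define H where "H k = (if l < n then pochhammer (c - real n - real k + 1) (n - l - 1) else 1 / (c - real n - real k))"
    for k
  define M where "M k = (-1) ^ k * pochhammer (\<sigma> + 1) (l + k) * pochhammer (\<beta> + 1) k * Gamma (\<gamma> + 1)
       * Gamma (\<gamma> - \<sigma> - \<beta> - 1 - real l - real k) / (Gamma (\<gamma> - \<sigma> - real l) * Gamma (\<gamma> - \<beta>))" for k
  have c: "2 * real n < c" using n by (simp add: c_def)
  have summand: "uni_coeff n \<sigma> \<beta> \<gamma> k * M k =
      K * ((-1) ^ k * real (n choose k) * pochhammer (\<sigma> + 1 + real k) l * H k)"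
    if k: "k \<le> n" for k
  proof -
    have kl: "real k \<le> real n" "real l \<le> real n" using k l by auto
    have arg: "c - real n - real k + 1 > 0" "c - real n - real k > 0" using c kl by linarith+
    then have notin: "c - real n - real k + 1 \<notin> \<int>\<^sub>\<le>\<^sub>0" "c - real n - real k \<notin> \<int>\<^sub>\<le>\<^sub>0"
      by (auto dest: nonpos_Ints_nonpos)
    have Gpos: "Gamma (c - real n - real k + 1) > 0" using arg by (intro Gamma_real_pos)
    have shift: "c - real n - real k + 1 + real k = c - real n + 1" by simp
    have Gk: "Gamma (c - real n + 1) = pochhammer (c - real n - real k + 1) k * Gamma (c - real n - real k + 1)"
      using pochhammer_Gamma[OF notin(1), of k] Gpos unfolding shift by simp
    have H: "pochhammer (c - real n - real k + 1) k * Gamma (c - real l - real k) = Gamma (c - real n + 1) * H k"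
    proof (cases "l < n")
      case True
      then have arg_eq: "c - real l - real k = c - real n - real k + 1 + real (n - l - 1)"
        by (simp add: of_nat_diff)
      have "Gamma (c - real l - real k) = H k * Gamma (c - real n - real k + 1)"
        unfolding arg_eq H_def using True Gpos by (simp add: pochhammer_Gamma[OF notin(1)])
      then show ?thesis using Gk by simp
    next
      case False
      then have "l = n" using l by simp
      moreover have "Gamma (c - real n - real k + 1) = (c - real n - real k) * Gamma (c - real n - real k)"
        using notin by (intro Gamma_plus1)
      ultimately show ?thesis using arg Gk by (simp add: H_def)
    qed
    have p1: "pochhammer (real n - \<gamma> + \<sigma> + \<beta> + 1) k = (-1) ^ k * pochhammer (c - real n - real k + 1) k"
      using pochhammer_minus[of "c - real n" k] by (simp add: c_def algebra_simps)
    have p2: "pochhammer (\<beta> + 1) n = pochhammer (\<beta> + 1) k * pochhammer (\<beta> + 1 + real k) (n - k)"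
      using k by (rule pochhammer_product)
    have p3: "pochhammer (\<sigma> + 1) (l + k) = pochhammer (\<sigma> + 1) k * pochhammer (\<sigma> + 1 + real k) l"
      by (subst pochhammer_product'[symmetric]) (simp add: add.commute)
    have pos: "pochhammer (\<sigma> + 1) k > 0" using \<sigma> by (intro pochhammer_pos) simp
    have sgn: "(-1) ^ k * ((-1) ^ k * x) = x" for x :: real
      by (simp flip: power_add mult.assoc)
    have "uni_coeff n \<sigma> \<beta> \<gamma> k * M k =
        (pochhammer (\<beta> + 1) k * pochhammer (\<beta> + 1 + real k) (n - k)) * Gamma (\<gamma> + 1)
        / (Gamma (\<gamma> - \<sigma> - real l) * Gamma (\<gamma> - \<beta>))
        * ((-1) ^ k * real (n choose k) * pochhammer (\<sigma> + 1 + real k) l)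
        * (pochhammer (c - real n - real k + 1) k * Gamma (c - real l - real k))"
      unfolding uni_coeff_def M_def pochhammer_minus_eq_binomial p1 p3 c_def
      using pos by (simp add: sgn mult_ac)
    also have "\<dots> = K * ((-1) ^ k * real (n choose k) * pochhammer (\<sigma> + 1 + real k) l * H k)"
      unfolding H K_def p2 by simp
    finally show ?thesis .
  qed
  have "((\<lambda>y. \<Sum>k\<le>n. uni_coeff n \<sigma> \<beta> \<gamma> k *
            (pochhammer (- real y) k * pochhammer (\<sigma> + 1 + real y) l * beta_weight \<sigma> \<beta> \<gamma> y)) has_sum
      (\<Sum>k\<le>n. uni_coeff n \<sigma> \<beta> \<gamma> k * M k)) UNIV"
    unfolding M_def
    using \<sigma> \<beta> n l by (intro has_sum_sum has_sum_cmult_right beta_weight_moment) auto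
  also have "(\<lambda>y. \<Sum>k\<le>n. uni_coeff n \<sigma> \<beta> \<gamma> k *
            (pochhammer (- real y) k * pochhammer (\<sigma> + 1 + real y) l * beta_weight \<sigma> \<beta> \<gamma> y)) = ?f"
    by (simp add: R_uni_scaled_eq_sum_uni_coeff sum_distrib_right mult.assoc)
  also have "(\<Sum>k\<le>n. uni_coeff n \<sigma> \<beta> \<gamma> k * M k) =
      K * (\<Sum>k\<le>n. (-1) ^ k * real (n choose k) * pochhammer (\<sigma> + 1 + real k) l * H k)"
    by (simp add: summand flip: sum_distrib_left)
  also have "\<dots> = ?S"
  proof (cases "l < n")
    case True
    define p where "p = pochhammer [:\<sigma> + 1, 1:] l * pochhammer [:c - real n + 1, -1:] (n - l - 1)"
    have "degree p \<le> l + (n - l - 1)"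
      unfolding p_def by (intro order_trans[OF degree_mult_le] add_mono degree_pochhammer_le) auto
    then have "degree p < n" using True by simp
    moreover have "poly p (real k) = pochhammer (\<sigma> + 1 + real k) l * H k" for k
      using True by (simp add: p_def poly_pochhammer H_def algebra_simps)
    ultimately show ?thesis
      using alternating_binomial_sum_poly[of p n] True by (simp add: mult.assoc)
  next
    case False
    then have [simp]: "l = n" using l by simp
    define P where "P = pochhammer (c - 2 * real n) (Suc n)"
    have arg: "c - 2 * real n > 0" using c by simp
    then have "P > 0" unfolding P_def by (intro pochhammer_pos)
    have "(\<Sum>k\<le>n. (-1) ^ k * real (n choose k) * pochhammer (\<sigma> + 1 + real k) l * H k) =
        (\<Sum>k\<le>n. (-1) ^ k * real (n choose k) * pochhammer (\<sigma> + 1 + real k) n / (c - real n - real k))"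
      by (simp add: H_def)
    also have "\<dots> = (-1) ^ n * fact n * pochhammer (\<sigma> + 1 + (c - real n)) n / pochhammer (c - real n - real n) (Suc n)"
    proof (rule alternating_binomial_sum_pochhammer_quotient)
      show "c - real n \<noteq> real k" if "k \<le> n" for k using c that by linarith
    qed
    also have "pochhammer (c - real n - real n) (Suc n) = P" by (simp add: P_def)
    also have "\<sigma> + 1 + (c - real n) = \<gamma> - \<beta> - real n" by (simp add: c_def)
    finally have sum: "(\<Sum>k\<le>n. (-1) ^ k * real (n choose k) * pochhammer (\<sigma> + 1 + real k) l * H k) =
        (-1) ^ n * fact n * pochhammer (\<gamma> - \<beta> - real n) n / P" .
    have "Gamma (c - real n + 1) = P * Gamma (c - 2 * real n)"
    proof -
      have "c - 2 * real n \<notin> \<int>\<^sub>\<le>\<^sub>0" using arg by (auto dest: nonpos_Ints_nonpos)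
      moreover have "Gamma (c - 2 * real n) > 0" using arg by (intro Gamma_real_pos)
      ultimately show ?thesis
        unfolding P_def by (subst pochhammer_Gamma) (auto simp: algebra_simps)
    qed
    then show ?thesis
      unfolding sum K_def using \<open>P > 0\<close> by (simp add: c_def)
  qed
  finally show ?thesis .
qed

text \<open>The squared norm of \<open>R_uni_scaled n\<close>, that is, \<open>sq_norm\<close> in dimension one.\<close>

definition uni_norm :: "nat \<Rightarrow> real \<Rightarrow> real \<Rightarrow> real \<Rightarrow> real" where
  "uni_norm n \<sigma> \<beta> \<gamma> =
     fact n * pochhammer (\<beta> + 1) n * pochhammer (\<gamma> - \<beta> - real n) n * pochhammer (\<gamma> - \<sigma> - \<beta> - 2 * real n) n
         * Gamma (\<gamma> + 1) * Gamma (\<gamma> - \<sigma> - \<beta> - 1 - 2 * real n)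
         / (pochhammer (\<sigma> + 1) n * Gamma (\<gamma> - \<sigma> - real n) * Gamma (\<gamma> - \<beta>))"

text \<open>
  The polynomial of lower degree \<open>m\<close> is expanded in the basis \<open>(\<sigma> + 1 + y)\<^sub>l\<close> by the Vandermonde
  identity; only the term with \<open>k = l = n = m\<close> survives.
\<close>

lemma R_uni_scaled_orthogonal:
  assumes \<sigma>: "\<sigma> > -1" and \<beta>: "\<beta> > -1"
    and n: "2 * real n < \<gamma> - \<sigma> - \<beta> - 1" and m: "2 * real m < \<gamma> - \<sigma> - \<beta> - 1"
  shows "((\<lambda>y. R_uni_scaled n (real y) \<sigma> \<beta> \<gamma> * R_uni_scaled m (real y) \<sigma> \<beta> \<gamma> * beta_weight \<sigma> \<beta> \<gamma> y) has_sum
     (if n = m then uni_norm n \<sigma> \<beta> \<gamma> else 0)) UNIV"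
  using n m
proof (induction m n rule: linorder_wlog)
  case (sym m n)
  then show ?case by (cases "m = n") (simp_all add: mult.commute[of "R_uni_scaled m _ \<sigma> \<beta> \<gamma>" "R_uni_scaled n _ \<sigma> \<beta> \<gamma>"])
next
  case (le m n)
  define e where "e k l = uni_coeff m \<sigma> \<beta> \<gamma> k * ((-1) ^ k * (real (k choose l) * pochhammer (- \<sigma> - real k) (k - l)))"
    for k l
  define V where "V = (-1) ^ n * fact n * pochhammer (\<beta> + 1) n * pochhammer (\<gamma> - \<beta> - real n) n * Gamma (\<gamma> + 1)
         * Gamma (\<gamma> - \<sigma> - \<beta> - 1 - 2 * real n) / (Gamma (\<gamma> - \<sigma> - real n) * Gamma (\<gamma> - \<beta>))"
  have expand: "R_uni_scaled m y \<sigma> \<beta> \<gamma> = (\<Sum>k\<le>m. \<Sum>l\<le>k. e k l * pochhammer (\<sigma> + 1 + y) l)" for y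
  proof -
    have "pochhammer (- y) k = (\<Sum>l\<le>k. (-1) ^ k * (real (k choose l) * pochhammer (- \<sigma> - real k) (k - l))
        * pochhammer (\<sigma> + 1 + y) l)" for k
    proof -
      have "pochhammer (- y) k = (-1) ^ k * pochhammer ((\<sigma> + 1 + y) + (- \<sigma> - real k)) k"
        by (simp add: pochhammer_minus algebra_simps)
      then show ?thesis
        unfolding pochhammer_binomial_sum[of "\<sigma> + 1 + y" "- \<sigma> - real k" k] sum_distrib_left
        by (simp add: mult_ac)
    qed
    then show ?thesis
      unfolding R_uni_scaled_eq_sum_uni_coeff e_def by (simp add: sum_distrib_left mult.assoc)
  qed
  have "((\<lambda>y. \<Sum>k\<le>m. \<Sum>l\<le>k. e k l *
      (R_uni_scaled n (real y) \<sigma> \<beta> \<gamma> * pochhammer (\<sigma> + 1 + real y) l * beta_weight \<sigma> \<beta> \<gamma> y)) has_sum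
      (\<Sum>k\<le>m. \<Sum>l\<le>k. e k l * (if l < n then 0 else V))) UNIV"
    unfolding V_def
    using \<sigma> \<beta> le by (intro has_sum_sum has_sum_cmult_right R_uni_scaled_moment) auto
  also have "(\<lambda>y. \<Sum>k\<le>m. \<Sum>l\<le>k. e k l *
      (R_uni_scaled n (real y) \<sigma> \<beta> \<gamma> * pochhammer (\<sigma> + 1 + real y) l * beta_weight \<sigma> \<beta> \<gamma> y)) =
      (\<lambda>y. R_uni_scaled n (real y) \<sigma> \<beta> \<gamma> * R_uni_scaled m (real y) \<sigma> \<beta> \<gamma> * beta_weight \<sigma> \<beta> \<gamma> y)"
    by (simp add: expand sum_distrib_left sum_distrib_right mult_ac)
  also have "(\<Sum>k\<le>m. \<Sum>l\<le>k. e k l * (if l < n then 0 else V)) = (if n = m then e n n * V else 0)"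
  proof -
    have "(\<Sum>k\<le>m. \<Sum>l\<le>k. e k l * (if l < n then 0 else V)) = (\<Sum>k\<le>m. \<Sum>l\<le>k. if l = n \<and> k = n then e n n * V else 0)"
      using \<open>m \<le> n\<close> by (intro sum.cong refl) auto
    also have "\<dots> = (\<Sum>k\<le>m. if k = n then e n n * V else 0)"
      by (intro sum.cong refl) (auto simp: sum.delta)
    also have "\<dots> = (if n = m then e n n * V else 0)"
      using \<open>m \<le> n\<close> by (auto simp: sum.delta)
    finally show ?thesis .
  qed
  also have "(if n = m then e n n * V else 0) =
     (if n = m then uni_norm n \<sigma> \<beta> \<gamma> else 0)"
  proof (cases "n = m")
    case [simp]: True
    have p1: "pochhammer (real n - \<gamma> + \<sigma> + \<beta> + 1) n = (-1) ^ n * pochhammer (\<gamma> - \<sigma> - \<beta> - 2 * real n) n"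
      using pochhammer_minus[of "\<gamma> - \<sigma> - \<beta> - 1 - real n" n] by (simp add: algebra_simps)
    have sgn: "(-1) ^ n * ((-1) ^ n * x) = x" for x :: real
      by (simp flip: power_add mult.assoc)
    have "e n n = (-1) ^ n * pochhammer (\<gamma> - \<sigma> - \<beta> - 2 * real n) n / pochhammer (\<sigma> + 1) n"
      unfolding e_def uni_coeff_def True[symmetric] p1 pochhammer_minus_eq_binomial by (simp add: sgn mult_ac)
    then show ?thesis by (simp add: V_def uni_norm_def sgn mult_ac)
  qed simp
  finally show ?case .
qed

section \<open>Orthogonality in several variables\<close>

lemma head_sum_0 [simp]: "head_sum y 0 = 0"
  by (simp add: head_sum_def)

lemma head_sum_Suc: "head_sum y (Suc d) = head_sum y d + y (Suc d)"
  by (simp add: head_sum_def)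

lemma vec_sum_eq_head_sum: "vec_sum d y = head_sum y d"
  by (simp add: vec_sum_def head_sum_def)

lemma vec_sum_0 [simp]: "vec_sum 0 y = 0"
  by (simp add: vec_sum_def)

lemma vec_sum_Suc: "vec_sum (Suc d) y = vec_sum d y + y (Suc d)"
  by (simp add: vec_sum_def)

lemma tail_sum_Suc: "j \<le> Suc d \<Longrightarrow> tail_sum (Suc d) y j = tail_sum d y j + y (Suc d)"
  by (simp add: tail_sum_def)

lemma head_sum_cong: "(\<And>i. i \<in> {1..d} \<Longrightarrow> x i = y i) \<Longrightarrow> head_sum x d = head_sum y d"
  unfolding head_sum_def by (intro sum.cong) auto

lemma real_vec_apply [simp]: "real_vec x i = real (x i)"
  by (simp add: real_vec_def)

lemma head_sum_real_vec: "head_sum (real_vec x) d = real (vec_sum d x)"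
  by (simp add: head_sum_def vec_sum_def)

lemma R_multi_0 [simp]: "R_multi 0 \<sigma> \<beta> \<gamma> \<nu> x = 1"
  by (simp add: R_multi_def)

lemma R_multi_cong:
  assumes "\<And>i. i \<in> {1..d} \<Longrightarrow> \<nu> i = \<mu> i" and "\<And>i. i \<in> {1..d} \<Longrightarrow> x i = y i"
  shows "R_multi d \<sigma> \<beta> \<gamma> \<nu> x = R_multi d \<sigma> \<beta> \<gamma> \<mu> y"
proof -
  have "tail_sum d \<nu> (j + 1) = tail_sum d \<mu> (j + 1)" "head_sum x (j - 1) = head_sum y (j - 1)"
    if "j \<in> {1..d}" for j
    unfolding tail_sum_def head_sum_def using that assms by (auto intro!: sum.cong)
  then show ?thesis
    unfolding R_multi_def alpha2_def alpha3_def using assms by (intro prod.cong) auto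
qed

text \<open>
  The last factor depends on the other variables only through their sum, and the remaining product
  is a polynomial of the same family with shifted parameters \<open>\<beta>\<close> and \<open>\<gamma>\<close>.
\<close>

lemma R_multi_Suc:
  "R_multi (Suc d) \<sigma> \<beta> \<gamma> \<nu> x =
     R_multi d \<sigma> (\<beta> + real (\<nu> (Suc d))) (\<gamma> - \<sigma> (Suc d) - real (\<nu> (Suc d)) - 1) \<nu> x
     * R_uni_scaled (\<nu> (Suc d)) (x (Suc d)) (\<sigma> (Suc d)) (\<beta> + head_sum x d) (\<gamma> + head_sum x d)"
proof -
  have "(\<Prod>j=1..d. R_uni_scaled (\<nu> j) (x j) (\<sigma> j) (alpha2 (Suc d) \<beta> \<nu> x j) (alpha3 (Suc d) \<sigma> \<gamma> \<nu> x j)) =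
      R_multi d \<sigma> (\<beta> + real (\<nu> (Suc d))) (\<gamma> - \<sigma> (Suc d) - real (\<nu> (Suc d)) - 1) \<nu> x"
    unfolding R_multi_def
  proof (intro prod.cong refl)
    fix j assume "j \<in> {1..d}"
    then have "alpha2 (Suc d) \<beta> \<nu> x j = alpha2 d (\<beta> + real (\<nu> (Suc d))) \<nu> x j"
      "alpha3 (Suc d) \<sigma> \<gamma> \<nu> x j = alpha3 d \<sigma> (\<gamma> - \<sigma> (Suc d) - real (\<nu> (Suc d)) - 1) \<nu> x j"
      by (simp_all add: alpha2_def alpha3_def tail_sum_Suc)
    then show "R_uni_scaled (\<nu> j) (x j) (\<sigma> j) (alpha2 (Suc d) \<beta> \<nu> x j) (alpha3 (Suc d) \<sigma> \<gamma> \<nu> x j) =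
        R_uni_scaled (\<nu> j) (x j) (\<sigma> j) (alpha2 d (\<beta> + real (\<nu> (Suc d))) \<nu> x j)
          (alpha3 d \<sigma> (\<gamma> - \<sigma> (Suc d) - real (\<nu> (Suc d)) - 1) \<nu> x j)"
      by simp
  qed
  then show ?thesis
    by (simp add: R_multi_def alpha2_def alpha3_def tail_sum_def)
qed

lemma weight_0 [simp]: "weight 0 \<sigma> \<beta> \<gamma> x = 1"
  by (simp add: weight_def)

lemma weight_cong: "(\<And>i. i \<in> {1..d} \<Longrightarrow> x i = y i) \<Longrightarrow> weight d \<sigma> \<beta> \<gamma> x = weight d \<sigma> \<beta> \<gamma> y"
  unfolding weight_def vec_sum_def by (auto intro!: arg_cong2[of _ _ _ _ "(*)"] prod.cong sum.cong)

lemma weight_Suc: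
  "weight (Suc d) \<sigma> \<beta> \<gamma> x = weight d \<sigma> \<beta> \<gamma> x
     * beta_weight (\<sigma> (Suc d)) (\<beta> + real (vec_sum d x)) (\<gamma> + real (vec_sum d x)) (x (Suc d))"
proof -
  have "pochhammer (\<beta> + 1) (vec_sum (Suc d) x) =
      pochhammer (\<beta> + 1) (vec_sum d x) * pochhammer (\<beta> + real (vec_sum d x) + 1) (x (Suc d))" for \<beta> :: real
    by (simp add: vec_sum_Suc pochhammer_product' algebra_simps)
  then show ?thesis
    by (simp add: weight_def beta_weight_def mult_ac)
qed

lemma weight_nonneg:
  assumes "\<And>i. i \<in> {1..d} \<Longrightarrow> \<sigma> i > -1" "\<beta> > -1" "\<gamma> > -1"
  shows "weight d \<sigma> \<beta> \<gamma> x \<ge> 0"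
proof -
  have "\<sigma> i + 1 > 0" if "i \<in> {1..d}" for i using assms(1)[OF that] by simp
  then show ?thesis
    unfolding weight_def using assms(2,3)
    by (intro mult_nonneg_nonneg prod_nonneg divide_nonneg_nonneg pochhammer_nonneg) auto
qed

lemma vec_sum_gt:
  fixes \<sigma> :: "nat \<Rightarrow> real"
  assumes "\<And>i. i \<in> {1..d} \<Longrightarrow> \<sigma> i > -1"
  shows "vec_sum d \<sigma> + real d \<ge> 0"
proof -
  have "vec_sum d \<sigma> + real d = (\<Sum>i=1..d. \<sigma> i + 1)"
    by (simp add: vec_sum_def sum.distrib)
  also have "\<dots> \<ge> 0" using assms by (intro sum_nonneg) (force dest: less_imp_le)
  finally show ?thesis .
qed

text \<open>
  Summation over the last variable turns the weight into a constant multiple of the weight with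
  exactly the parameters that occur in \<open>R_multi_Suc\<close>.
\<close>

lemma weight_mult_uni_norm:
  assumes "\<gamma> > -1" and "\<gamma> - \<sigma>' - real n > 0"
  shows "weight d \<sigma> \<beta> \<gamma> x * uni_norm n \<sigma>' (\<beta> + real (vec_sum d x)) (\<gamma> + real (vec_sum d x)) =
     uni_norm n \<sigma>' \<beta> \<gamma> * weight d \<sigma> (\<beta> + real n) (\<gamma> - \<sigma>' - real n - 1) x"
proof -
  define X where "X = vec_sum d x"
  have *: "Gamma (y + real X) = pochhammer y X * Gamma y" "pochhammer y X > 0" if "y > 0" for y
  proof -
    have "y \<notin> \<int>\<^sub>\<le>\<^sub>0" using that by (auto dest: nonpos_Ints_nonpos)
    then show "Gamma (y + real X) = pochhammer y X * Gamma y"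
      using Gamma_real_pos[OF that] by (simp add: pochhammer_Gamma)
    show "pochhammer y X > 0" using that by (rule pochhammer_pos)
  qed
  have G1: "Gamma (\<gamma> + real X + 1) = pochhammer (\<gamma> + 1) X * Gamma (\<gamma> + 1)" "pochhammer (\<gamma> + 1) X > 0"
    using *[of "\<gamma> + 1"] assms(1) by (simp_all add: algebra_simps)
  have G2: "Gamma (\<gamma> + real X - \<sigma>' - real n) = pochhammer (\<gamma> - \<sigma>' - real n) X * Gamma (\<gamma> - \<sigma>' - real n)"
    using *(1)[OF assms(2)] by (simp add: algebra_simps)
  have P: "pochhammer (\<beta> + 1) X * pochhammer (\<beta> + real X + 1) n =
      pochhammer (\<beta> + 1) n * pochhammer (\<beta> + real n + 1) X"
    using pochhammer_product'[of "\<beta> + 1" X n] pochhammer_product'[of "\<beta> + 1" n X]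
    by (simp add: ac_simps)
  have args: "\<gamma> + real X - (\<beta> + real X) = \<gamma> - \<beta>"
    "\<gamma> + real X - \<sigma>' - (\<beta> + real X) = \<gamma> - \<sigma>' - \<beta>"
    "\<gamma> - \<sigma>' - real n - 1 + 1 = \<gamma> - \<sigma>' - real n" by simp_all
  define W where "W = (\<Prod>i=1..d. pochhammer (\<sigma> i + 1) (x i) / fact (x i))"
  have "weight d \<sigma> \<beta> \<gamma> x * uni_norm n \<sigma>' (\<beta> + real X) (\<gamma> + real X) =
     W * (pochhammer (\<beta> + 1) X * pochhammer (\<beta> + real X + 1) n) / pochhammer (\<gamma> + 1) X
      * (fact n * pochhammer (\<gamma> - \<beta> - real n) n * pochhammer (\<gamma> - \<sigma>' - \<beta> - 2 * real n) n
         * Gamma (\<gamma> + real X + 1) * Gamma (\<gamma> - \<sigma>' - \<beta> - 1 - 2 * real n)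
         / (pochhammer (\<sigma>' + 1) n * Gamma (\<gamma> + real X - \<sigma>' - real n) * Gamma (\<gamma> - \<beta>)))"
    unfolding weight_def uni_norm_def args W_def[symmetric] X_def[symmetric] by simp
  also have "\<dots> = uni_norm n \<sigma>' \<beta> \<gamma> * weight d \<sigma> (\<beta> + real n) (\<gamma> - \<sigma>' - real n - 1) x"
    unfolding P G1(1) G2 weight_def uni_norm_def args W_def[symmetric] X_def[symmetric]
    using G1(2) by (simp add: mult_ac)
  finally show ?thesis by (simp add: X_def)
qed

lemma sq_norm_0:
  assumes "\<gamma> > -1" "\<gamma> > \<beta>"
  shows "sq_norm 0 \<sigma> \<beta> \<gamma> \<nu> = 1"
proof -
  have "Gamma (1 + \<gamma>) > 0" "Gamma (\<gamma> - \<beta>) > 0" using assms by (auto intro!: Gamma_real_pos)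
  then show ?thesis by (simp add: sq_norm_def add.commute[of \<gamma>])
qed

lemma sq_norm_Suc:
  fixes d :: nat and \<nu> :: "nat \<Rightarrow> nat" and \<sigma> :: "nat \<Rightarrow> real"
  defines "n \<equiv> \<nu> (Suc d)" and "s \<equiv> \<sigma> (Suc d)"
  assumes "\<gamma> - s - real n > 0" and "\<gamma> - \<beta> - s - 2 * real n - 1 > 0"
  shows "sq_norm (Suc d) \<sigma> \<beta> \<gamma> \<nu> =
     uni_norm n s \<beta> \<gamma> * sq_norm d \<sigma> (\<beta> + real n) (\<gamma> - s - real n - 1) \<nu>"
proof -
  let ?\<beta> = "\<beta> + real n" and ?\<gamma> = "\<gamma> - s - real n - 1"
  define F where "F j = fact (\<nu> j) * pochhammer (alpha32 d \<sigma> ?\<beta> ?\<gamma> \<nu> j - real (\<nu> j)) (\<nu> j)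
          * pochhammer (alpha32 d \<sigma> ?\<beta> ?\<gamma> \<nu> (j - 1) + 1) (\<nu> j) / pochhammer (1 + \<sigma> j) (\<nu> j)" for j
  have alpha: "alpha32 (Suc d) \<sigma> \<beta> \<gamma> \<nu> j = alpha32 d \<sigma> ?\<beta> ?\<gamma> \<nu> j" if "j \<le> d" for j
    using that by (simp add: alpha32_def tail_sum_Suc n_def s_def algebra_simps)
  have prod_eq: "(\<Prod>j=1..Suc d. fact (\<nu> j) * pochhammer (alpha32 (Suc d) \<sigma> \<beta> \<gamma> \<nu> j - real (\<nu> j)) (\<nu> j)
          * pochhammer (alpha32 (Suc d) \<sigma> \<beta> \<gamma> \<nu> (j - 1) + 1) (\<nu> j) / pochhammer (1 + \<sigma> j) (\<nu> j)) =
      (\<Prod>j=1..d. F j) * (fact n * pochhammer (\<gamma> - \<beta> - real n) n * pochhammer (\<gamma> - s - \<beta> - 2 * real n) n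
        / pochhammer (s + 1) n)"
  proof -
    have "(\<Prod>j=1..d. fact (\<nu> j) * pochhammer (alpha32 (Suc d) \<sigma> \<beta> \<gamma> \<nu> j - real (\<nu> j)) (\<nu> j)
          * pochhammer (alpha32 (Suc d) \<sigma> \<beta> \<gamma> \<nu> (j - 1) + 1) (\<nu> j) / pochhammer (1 + \<sigma> j) (\<nu> j)) = (\<Prod>j=1..d. F j)"
      unfolding F_def
    proof (intro prod.cong refl)
      fix j assume j: "j \<in> {1..d}"
      then have "j \<le> d" "j - 1 \<le> d" by auto
      then show "fact (\<nu> j) * pochhammer (alpha32 (Suc d) \<sigma> \<beta> \<gamma> \<nu> j - real (\<nu> j)) (\<nu> j)
          * pochhammer (alpha32 (Suc d) \<sigma> \<beta> \<gamma> \<nu> (j - 1) + 1) (\<nu> j) / pochhammer (1 + \<sigma> j) (\<nu> j) =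
        fact (\<nu> j) * pochhammer (alpha32 d \<sigma> ?\<beta> ?\<gamma> \<nu> j - real (\<nu> j)) (\<nu> j)
          * pochhammer (alpha32 d \<sigma> ?\<beta> ?\<gamma> \<nu> (j - 1) + 1) (\<nu> j) / pochhammer (1 + \<sigma> j) (\<nu> j)"
        by (simp only: alpha)
    qed
    moreover have "alpha32 (Suc d) \<sigma> \<beta> \<gamma> \<nu> (Suc d) = \<gamma> - \<beta>"
      "alpha32 (Suc d) \<sigma> \<beta> \<gamma> \<nu> d + 1 = \<gamma> - s - \<beta> - 2 * real n"
      by (simp_all add: alpha32_def tail_sum_def n_def s_def)
    ultimately show ?thesis by (simp add: n_def s_def add.commute)
  qed
  have vec_eq: "pochhammer (1 + \<beta>) (vec_sum (Suc d) \<nu>) = pochhammer (\<beta> + 1) n * pochhammer (1 + ?\<beta>) (vec_sum d \<nu>)"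
    using pochhammer_product'[of "1 + \<beta>" n "vec_sum d \<nu>"] by (simp add: vec_sum_Suc n_def ac_simps)
  have args: "\<gamma> - \<beta> - vec_sum (Suc d) \<sigma> - 2 * real (vec_sum (Suc d) \<nu>) - real (Suc d) =
      ?\<gamma> - ?\<beta> - vec_sum d \<sigma> - 2 * real (vec_sum d \<nu>) - real d"
    "\<gamma> - vec_sum (Suc d) \<sigma> - real (vec_sum (Suc d) \<nu>) + 1 - real (Suc d) =
      ?\<gamma> - vec_sum d \<sigma> - real (vec_sum d \<nu>) + 1 - real d"
    by (simp_all add: vec_sum_Suc n_def s_def)
  have args': "1 + ?\<gamma> = \<gamma> - s - real n" "?\<gamma> - ?\<beta> = \<gamma> - s - \<beta> - 1 - 2 * real n"
    by simp_all
  define Q where "Q = pochhammer (1 + ?\<beta>) (vec_sum d \<nu>)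
      * Gamma (?\<gamma> - ?\<beta> - vec_sum d \<sigma> - 2 * real (vec_sum d \<nu>) - real d)
      / Gamma (?\<gamma> - vec_sum d \<sigma> - real (vec_sum d \<nu>) + 1 - real d)"
  define P where "P = (\<Prod>j=1..d. F j)"
  have "sq_norm (Suc d) \<sigma> \<beta> \<gamma> \<nu> = Q * pochhammer (\<beta> + 1) n * Gamma (1 + \<gamma>) / Gamma (\<gamma> - \<beta>)
      * (P * (fact n * pochhammer (\<gamma> - \<beta> - real n) n * pochhammer (\<gamma> - s - \<beta> - 2 * real n) n
        / pochhammer (s + 1) n))"
    unfolding sq_norm_def prod_eq vec_eq args Q_def P_def by simp
  moreover have "sq_norm d \<sigma> ?\<beta> ?\<gamma> \<nu> = Q * Gamma (\<gamma> - s - real n) / Gamma (\<gamma> - s - \<beta> - 1 - 2 * real n) * P"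
    unfolding sq_norm_def Q_def P_def F_def args' by simp
  moreover have "Gamma (\<gamma> - s - real n) > 0" "Gamma (\<gamma> - s - \<beta> - 1 - 2 * real n) > 0"
    using assms by (auto intro!: Gamma_real_pos)
  ultimately show ?thesis
    unfolding uni_norm_def add.commute[of 1 \<gamma>] by (simp add: mult_ac)
qed

lemma bij_betw_multi_indices_Suc:
  "bij_betw (\<lambda>(x, y). x(Suc d := y)) (multi_indices d \<times> UNIV) (multi_indices (Suc d))"
proof (rule bij_betwI[where g = "\<lambda>x. (x(Suc d := undefined), x (Suc d))"])
  have Suc: "{1..Suc d} = insert (Suc d) {1..d}" by auto
  show "(\<lambda>(x, y). x(Suc d := y)) \<in> multi_indices d \<times> UNIV \<rightarrow> multi_indices (Suc d)"
    unfolding multi_indices_def Suc by (auto simp: PiE_def extensional_def)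
  show "(\<lambda>x. (x(Suc d := undefined), x (Suc d))) \<in> multi_indices (Suc d) \<rightarrow> multi_indices d \<times> UNIV"
    unfolding multi_indices_def Suc by (auto simp: PiE_def extensional_def)
  show "(\<lambda>x. (x(Suc d := undefined), x (Suc d))) (case p of (x, y) \<Rightarrow> x(Suc d := y)) = p"
    if "p \<in> multi_indices d \<times> UNIV" for p
    using that by (auto simp: multi_indices_def PiE_def extensional_def fun_eq_iff)
qed auto

text \<open>The summand of the orthogonality relation.\<close>

definition product_term ::
    "nat \<Rightarrow> (nat \<Rightarrow> real) \<Rightarrow> real \<Rightarrow> real \<Rightarrow> (nat \<Rightarrow> nat) \<Rightarrow> (nat \<Rightarrow> nat) \<Rightarrow> (nat \<Rightarrow> nat) \<Rightarrow> real" where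
  "product_term d \<sigma> \<beta> \<gamma> \<nu> \<mu> x =
     R_multi d \<sigma> \<beta> \<gamma> \<nu> (real_vec x) * R_multi d \<sigma> \<beta> \<gamma> \<mu> (real_vec x) * weight d \<sigma> \<beta> \<gamma> x"

lemma product_term_slice_has_sum:
  fixes d :: nat and \<nu> \<mu> x :: "nat \<Rightarrow> nat" and \<sigma> :: "nat \<Rightarrow> real"
  defines "n \<equiv> \<nu> (Suc d)" and "m \<equiv> \<mu> (Suc d)" and "s \<equiv> \<sigma> (Suc d)"
  assumes \<sigma>: "\<And>i. i \<in> {1..Suc d} \<Longrightarrow> \<sigma> i > -1" and \<beta>: "\<beta> > -1"
    and \<nu>: "2 * real (vec_sum (Suc d) \<nu>) < \<gamma> - vec_sum (Suc d) \<sigma> - \<beta> - real (Suc d) - 1"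
    and \<mu>: "2 * real (vec_sum (Suc d) \<mu>) < \<gamma> - vec_sum (Suc d) \<sigma> - \<beta> - real (Suc d) - 1"
  shows "((\<lambda>y. product_term (Suc d) \<sigma> \<beta> \<gamma> \<nu> \<mu> (x(Suc d := y))) has_sum
     (if n = m then uni_norm n s \<beta> \<gamma> * product_term d \<sigma> (\<beta> + real n) (\<gamma> - s - real n - 1) \<nu> \<mu> x else 0)) UNIV"
proof -
  define X where "X = vec_sum d x"
  define R where "R \<nu> = R_multi d \<sigma> (\<beta> + real (\<nu> (Suc d))) (\<gamma> - s - real (\<nu> (Suc d)) - 1) \<nu> (real_vec x)"
    for \<nu> :: "nat \<Rightarrow> nat"
  have s: "s > -1" using \<sigma> by (simp add: s_def)
  have N: "vec_sum d \<sigma> + real d \<ge> 0" using \<sigma> by (intro vec_sum_gt) auto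
  have n: "2 * real n < \<gamma> - s - \<beta> - 2" and m: "2 * real m < \<gamma> - s - \<beta> - 2"
    using \<nu> \<mu> N by (simp_all add: vec_sum_Suc n_def m_def s_def)
  have slice: "R_multi (Suc d) \<sigma> \<beta> \<gamma> \<nu> (real_vec (x(Suc d := y))) =
      R \<nu> * R_uni_scaled (\<nu> (Suc d)) (real y) s (\<beta> + real X) (\<gamma> + real X)" for \<nu> y
  proof -
    have "R_multi d \<sigma> (\<beta> + real (\<nu> (Suc d))) (\<gamma> - s - real (\<nu> (Suc d)) - 1) \<nu> (real_vec (x(Suc d := y))) = R \<nu>"
      unfolding R_def by (intro R_multi_cong) auto
    moreover have "head_sum (real_vec (x(Suc d := y))) d = real X"
      unfolding X_def head_sum_real_vec[symmetric] by (intro head_sum_cong) auto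
    ultimately show ?thesis by (simp add: R_multi_Suc s_def)
  qed
  have slice_weight: "weight (Suc d) \<sigma> \<beta> \<gamma> (x(Suc d := y)) =
      weight d \<sigma> \<beta> \<gamma> x * beta_weight s (\<beta> + real X) (\<gamma> + real X) y" for y
  proof -
    have "weight d \<sigma> \<beta> \<gamma> (x(Suc d := y)) = weight d \<sigma> \<beta> \<gamma> x" by (intro weight_cong) auto
    moreover have "vec_sum d (x(Suc d := y)) = X"
      unfolding X_def vec_sum_eq_head_sum by (intro head_sum_cong) auto
    ultimately show ?thesis by (simp add: weight_Suc s_def)
  qed
  have "((\<lambda>y. R \<nu> * R \<mu> * weight d \<sigma> \<beta> \<gamma> x *
        (R_uni_scaled n (real y) s (\<beta> + real X) (\<gamma> + real X) * R_uni_scaled m (real y) s (\<beta> + real X) (\<gamma> + real X)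
          * beta_weight s (\<beta> + real X) (\<gamma> + real X) y)) has_sum
      R \<nu> * R \<mu> * weight d \<sigma> \<beta> \<gamma> x * (if n = m then uni_norm n s (\<beta> + real X) (\<gamma> + real X) else 0)) UNIV"
    using s \<beta> n m by (intro has_sum_cmult_right R_uni_scaled_orthogonal) auto
  also have "(\<lambda>y. R \<nu> * R \<mu> * weight d \<sigma> \<beta> \<gamma> x *
        (R_uni_scaled n (real y) s (\<beta> + real X) (\<gamma> + real X) * R_uni_scaled m (real y) s (\<beta> + real X) (\<gamma> + real X)
          * beta_weight s (\<beta> + real X) (\<gamma> + real X) y)) =
      (\<lambda>y. product_term (Suc d) \<sigma> \<beta> \<gamma> \<nu> \<mu> (x(Suc d := y)))"
    unfolding product_term_def slice slice_weight n_def m_def by (simp add: mult_ac)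
  also have "R \<nu> * R \<mu> * weight d \<sigma> \<beta> \<gamma> x * (if n = m then uni_norm n s (\<beta> + real X) (\<gamma> + real X) else 0) =
     (if n = m then uni_norm n s \<beta> \<gamma> * product_term d \<sigma> (\<beta> + real n) (\<gamma> - s - real n - 1) \<nu> \<mu> x else 0)"
  proof (cases "n = m")
    case True
    have "weight d \<sigma> \<beta> \<gamma> x * uni_norm n s (\<beta> + real X) (\<gamma> + real X) =
        uni_norm n s \<beta> \<gamma> * weight d \<sigma> (\<beta> + real n) (\<gamma> - s - real n - 1) x"
      unfolding X_def using n \<beta> s by (intro weight_mult_uni_norm) linarith+
    with True show ?thesis
      by (simp add: product_term_def R_def n_def m_def mult_ac)
  qed simp
  finally show ?thesis .
qed

lemma R_multi_square_has_sum:
  assumes "\<And>i. i \<in> {1..d} \<Longrightarrow> \<sigma> i > -1" and "\<beta> > -1"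
    and "2 * real (vec_sum d \<nu>) < \<gamma> - vec_sum d \<sigma> - \<beta> - real d - 1"
  shows "(product_term d \<sigma> \<beta> \<gamma> \<nu> \<nu> has_sum sq_norm d \<sigma> \<beta> \<gamma> \<nu>) (multi_indices d)"
  using assms
proof (induction d arbitrary: \<beta> \<gamma>)
  case 0
  then show ?case
    by (simp add: product_term_def sq_norm_0 multi_indices_def has_sum_finite_iff)
next
  case (Suc d \<beta> \<gamma>)
  define n where "n = \<nu> (Suc d)"
  define s where "s = \<sigma> (Suc d)"
  define B where "B = uni_norm n s \<beta> \<gamma>"
  have s: "s > -1" using Suc.prems by (simp add: s_def)
  have N: "vec_sum d \<sigma> + real d \<ge> 0" using Suc.prems by (intro vec_sum_gt) auto
  have ad: "2 * real (vec_sum d \<nu>) < \<gamma> - \<beta> - 2 * real n - s - vec_sum d \<sigma> - real d - 2"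
    using Suc.prems by (simp add: vec_sum_Suc n_def s_def)
  have pos: "\<gamma> - s - real n > 0" "\<gamma> - \<beta> - s - 2 * real n - 1 > 0" "\<gamma> > -1"
    using ad N s Suc.prems by linarith+
  let ?g = "\<lambda>x. B * product_term d \<sigma> (\<beta> + real n) (\<gamma> - s - real n - 1) \<nu> \<nu> x"
  let ?f = "\<lambda>(x, y). product_term (Suc d) \<sigma> \<beta> \<gamma> \<nu> \<nu> (x(Suc d := y))"
  have inner: "((\<lambda>y. ?f (x, y)) has_sum ?g x) UNIV" for x
    using product_term_slice_has_sum[of d \<sigma> \<beta> \<nu> \<gamma> \<nu> x] Suc.prems by (simp add: B_def n_def s_def)
  have "(product_term d \<sigma> (\<beta> + real n) (\<gamma> - s - real n - 1) \<nu> \<nu> has_sum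
      sq_norm d \<sigma> (\<beta> + real n) (\<gamma> - s - real n - 1) \<nu>) (multi_indices d)"
    using Suc.prems ad by (intro Suc.IH) (auto simp: add_strict_increasing)
  then have outer: "(?g has_sum B * sq_norm d \<sigma> (\<beta> + real n) (\<gamma> - s - real n - 1) \<nu>) (multi_indices d)"
    by (rule has_sum_cmult_right)
  have "(?f has_sum B * sq_norm d \<sigma> (\<beta> + real n) (\<gamma> - s - real n - 1) \<nu>) (multi_indices d \<times> UNIV)"
  proof (rule has_sum_SigmaI[OF inner outer], rule summable_on_SigmaI[OF inner])
    show "?g summable_on multi_indices d" using outer by (rule has_sum_imp_summable)
    show "?f (x, y) \<ge> 0" for x y
      unfolding product_term_def prod.case using Suc.prems pos
      by (intro mult_nonneg_nonneg[OF zero_le_square] weight_nonneg) auto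
  qed
  also have "?f = (\<lambda>p. product_term (Suc d) \<sigma> \<beta> \<gamma> \<nu> \<nu> (case p of (x, y) \<Rightarrow> x(Suc d := y)))"
    by auto
  also have "B * sq_norm d \<sigma> (\<beta> + real n) (\<gamma> - s - real n - 1) \<nu> = sq_norm (Suc d) \<sigma> \<beta> \<gamma> \<nu>"
    using pos unfolding B_def n_def s_def by (intro sq_norm_Suc[symmetric]) auto
  finally show ?case
    unfolding has_sum_reindex_bij_betw[OF bij_betw_multi_indices_Suc] .
qed

text \<open>
  Absolute convergence of the mixed products follows from that of the squares, which are
  nonnegative and can therefore be summed iteratively.
\<close>

lemma product_term_summable:
  assumes "\<And>i. i \<in> {1..d} \<Longrightarrow> \<sigma> i > -1" and "\<beta> > -1"
    and "2 * real (vec_sum d \<nu>) < \<gamma> - vec_sum d \<sigma> - \<beta> - real d - 1"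
    and "2 * real (vec_sum d \<mu>) < \<gamma> - vec_sum d \<sigma> - \<beta> - real d - 1"
  shows "product_term d \<sigma> \<beta> \<gamma> \<nu> \<mu> summable_on multi_indices d"
proof (rule abs_summable_summable, rule summable_on_comparison_test)
  show "(\<lambda>x. product_term d \<sigma> \<beta> \<gamma> \<nu> \<nu> x + product_term d \<sigma> \<beta> \<gamma> \<mu> \<mu> x) summable_on multi_indices d"
    using R_multi_square_has_sum[OF assms(1,2,3)] R_multi_square_has_sum[OF assms(1,2,4)]
    by (intro summable_on_add) (auto dest: has_sum_imp_summable)
  fix x
  have "vec_sum d \<sigma> + real d \<ge> 0" using assms by (intro vec_sum_gt) auto
  then have "\<gamma> > -1" using assms(2,3) by linarith
  then have w: "weight d \<sigma> \<beta> \<gamma> x \<ge> 0" using assms by (intro weight_nonneg) auto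
  have "\<bar>a * b\<bar> \<le> a * a + b * b" for a b :: real
  proof -
    have "2 * (\<bar>a\<bar> * \<bar>b\<bar>) \<le> a * a + b * b" "\<bar>a\<bar> * \<bar>b\<bar> \<ge> 0"
      using sum_squares_bound[of "\<bar>a\<bar>" "\<bar>b\<bar>"] by (simp_all add: power2_eq_square)
    then show ?thesis unfolding abs_mult by linarith
  qed
  from mult_right_mono[OF this w]
  show "norm (product_term d \<sigma> \<beta> \<gamma> \<nu> \<mu> x) \<le> product_term d \<sigma> \<beta> \<gamma> \<nu> \<nu> x + product_term d \<sigma> \<beta> \<gamma> \<mu> \<mu> x"
    using w unfolding product_term_def by (simp add: abs_mult distrib_right)
qed simp

lemma R_multi_orthogonal:
  assumes "\<And>i. i \<in> {1..d} \<Longrightarrow> \<sigma> i > -1" and "\<beta> > -1"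
    and "2 * real (vec_sum d \<nu>) < \<gamma> - vec_sum d \<sigma> - \<beta> - real d - 1"
    and "2 * real (vec_sum d \<mu>) < \<gamma> - vec_sum d \<sigma> - \<beta> - real d - 1"
    and "i \<in> {1..d}" and "\<nu> i \<noteq> \<mu> i"
  shows "(product_term d \<sigma> \<beta> \<gamma> \<nu> \<mu> has_sum 0) (multi_indices d)"
  using assms
proof (induction d arbitrary: \<beta> \<gamma>)
  case (Suc d \<beta> \<gamma>)
  define n where "n = \<nu> (Suc d)"
  define s where "s = \<sigma> (Suc d)"
  define g where "g x = (if n = \<mu> (Suc d) then
      uni_norm n s \<beta> \<gamma> * product_term d \<sigma> (\<beta> + real n) (\<gamma> - s - real n - 1) \<nu> \<mu> x else 0)" for x
  let ?f = "\<lambda>(x, y). product_term (Suc d) \<sigma> \<beta> \<gamma> \<nu> \<mu> (x(Suc d := y))"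
  have inner: "((\<lambda>y. ?f (x, y)) has_sum g x) UNIV" for x
    unfolding g_def n_def s_def prod.case using Suc.prems by (intro product_term_slice_has_sum) auto
  have outer: "(g has_sum 0) (multi_indices d)"
  proof (cases "n = \<mu> (Suc d)")
    case True
    then have "i \<in> {1..d}" using Suc.prems(5,6) by (auto simp: n_def le_Suc_eq)
    then have "(product_term d \<sigma> (\<beta> + real n) (\<gamma> - s - real n - 1) \<nu> \<mu> has_sum 0) (multi_indices d)"
      using Suc.prems True by (intro Suc.IH) (auto simp: add_strict_increasing vec_sum_Suc n_def s_def)
    then have "((\<lambda>x. uni_norm n s \<beta> \<gamma> * product_term d \<sigma> (\<beta> + real n) (\<gamma> - s - real n - 1) \<nu> \<mu> x)
        has_sum uni_norm n s \<beta> \<gamma> * 0) (multi_indices d)"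
      by (rule has_sum_cmult_right)
    then show ?thesis using True unfolding g_def by simp
  next
    case False
    then show ?thesis unfolding g_def by simp
  qed
  have "product_term (Suc d) \<sigma> \<beta> \<gamma> \<nu> \<mu> summable_on multi_indices (Suc d)"
    using Suc.prems by (intro product_term_summable) auto
  then have "(\<lambda>p. product_term (Suc d) \<sigma> \<beta> \<gamma> \<nu> \<mu> (case p of (x, y) \<Rightarrow> x(Suc d := y)))
      summable_on multi_indices d \<times> UNIV"
    unfolding summable_on_reindex_bij_betw[OF bij_betw_multi_indices_Suc] .
  also have eq: "(\<lambda>p. product_term (Suc d) \<sigma> \<beta> \<gamma> \<nu> \<mu> (case p of (x, y) \<Rightarrow> x(Suc d := y))) = ?f"
    by auto
  finally have "(?f has_sum 0) (multi_indices d \<times> UNIV)"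
    by (rule has_sum_SigmaI[OF inner outer])
  then show ?case
    unfolding eq[symmetric] has_sum_reindex_bij_betw[OF bij_betw_multi_indices_Suc] .
qed simp

section \<open>Contiguous relations and the difference equation in one variable\<close>

lemma backward_diff_pochhammer:
  "y * (pochhammer (- y) k - pochhammer (- (y - 1)) k) = real k * pochhammer (- y) k"
proof (cases k)
  case (Suc m)
  have 1: "pochhammer (- y) (Suc m) = - y * pochhammer (1 - y) m"
    by (simp add: pochhammer_rec add.commute)
  have 2: "pochhammer (- (y - 1)) (Suc m) = pochhammer (1 - y) m * (1 - y + real m)"
    by (simp add: pochhammer_Suc)
  show ?thesis unfolding Suc 1 2 by (simp add: algebra_simps)
qed simp

lemma forward_diff_pochhammer:
  fixes s y :: real
  shows "(s + 1 + y) * (pochhammer (- (y + 1)) k - pochhammer (- y) k) =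
           real k * pochhammer (- y) k - real k * (s + real k) * pochhammer (- y) (k - 1)"
proof (cases k)
  case (Suc m)
  have 1: "pochhammer (- (y + 1)) (Suc m) = - (y + 1) * pochhammer (- y) m"
    by (simp add: pochhammer_rec)
  have 2: "pochhammer (- y) (Suc m) = pochhammer (- y) m * (real m - y)"
    by (simp add: pochhammer_Suc)
  show ?thesis unfolding Suc 1 2 by (simp add: algebra_simps)
qed simp

text \<open>
  The part of \<open>uni_coeff\<close> that depends on \<open>\<beta>\<close> and \<open>\<gamma>\<close> only through \<open>\<delta> = \<gamma> - \<beta>\<close>; it is the same
  for all polynomials in a contiguous relation below.
\<close>

definition uni_base :: "nat \<Rightarrow> real \<Rightarrow> real \<Rightarrow> nat \<Rightarrow> real" where
  "uni_base n \<sigma> \<delta> k =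
     pochhammer (- real n) k * pochhammer (real n - \<delta> + \<sigma> + 1) k / (pochhammer (\<sigma> + 1) k * fact k)"

lemma uni_coeff_eq_uni_base:
  "uni_coeff n \<sigma> \<beta> \<gamma> k = uni_base n \<sigma> (\<gamma> - \<beta>) k * pochhammer (\<beta> + 1 + real k) (n - k)"
  by (simp add: uni_coeff_def uni_base_def algebra_simps)

lemma uni_base_rec:
  assumes "\<sigma> > -1"
  shows "real (Suc k) * (\<sigma> + real (Suc k)) * uni_base n \<sigma> \<delta> (Suc k) =
           (real k - real n) * (real n - \<delta> + \<sigma> + 1 + real k) * uni_base n \<sigma> \<delta> k"
proof -
  have "pochhammer (\<sigma> + 1) k > 0" using assms by (intro pochhammer_pos) simp
  then show ?thesis
    using assms by (simp add: uni_base_def pochhammer_Suc divide_simps)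
qed

lemma uni_base_eq_0: "k > n \<Longrightarrow> uni_base n \<sigma> \<delta> k = 0"
  by (simp add: uni_base_def pochhammer_of_nat_eq_0_lemma)

lemma sum_pred_shift:
  fixes u :: "nat \<Rightarrow> 'a::comm_ring_1" and \<phi> :: "nat \<Rightarrow> 'a"
  assumes "u 0 = 0" and "u (Suc n) = 0"
  shows "(\<Sum>k\<le>n. u k * \<phi> (k - 1)) = (\<Sum>k\<le>n. u (Suc k) * \<phi> k)"
proof -
  have "(\<Sum>k\<le>Suc n. u k * \<phi> (k - 1)) = (\<Sum>k\<le>n. u (Suc k) * \<phi> k)"
    using assms(1) by (subst sum.atMost_Suc_shift) simp
  then show ?thesis using assms(2) by simp
qed

text \<open>
  The next two relations compare parameters \<open>(b, h)\<close> with \<open>(b + 1, h + 1)\<close> and \<open>(b - 1, h - 1)\<close>,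
  as happens when the sum of the preceding variables changes by one.
\<close>

lemma R_uni_scaled_raise:
  "y * R_uni_scaled n (y - 1) s (b + 1) (h + 1) - (y + b + 1) * R_uni_scaled n y s (b + 1) (h + 1) =
     - (b + real n + 1) * R_uni_scaled n y s b h"
proof -
  let ?a = "uni_coeff n s b h" and ?a' = "uni_coeff n s (b + 1) (h + 1)"
  have coeff: "(real k + b + 1) * ?a' k = (b + real n + 1) * ?a k" if "k \<le> n" for k
  proof -
    have "(b + 1 + real k) * pochhammer (b + 1 + real k + 1) (n - k) =
        pochhammer (b + 1 + real k) (n - k) * (b + 1 + real k + real (n - k))"
      by (simp only: flip: pochhammer_rec pochhammer_Suc)
    then show ?thesis
      using that unfolding uni_coeff_eq_uni_base by (simp add: of_nat_diff add_ac mult_ac)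
  qed
  have "y * R_uni_scaled n (y - 1) s (b + 1) (h + 1) - (y + b + 1) * R_uni_scaled n y s (b + 1) (h + 1) =
      (\<Sum>k\<le>n. ?a' k * (y * pochhammer (- (y - 1)) k - (y + b + 1) * pochhammer (- y) k))"
    unfolding R_uni_scaled_eq_sum_uni_coeff sum_distrib_left
    by (simp only: flip: sum_subtractf) (simp add: algebra_simps)
  also have "\<dots> = (\<Sum>k\<le>n. - (b + real n + 1) * (?a k * pochhammer (- y) k))"
  proof (intro sum.cong refl)
    fix k assume k: "k \<in> {..n}"
    have basis: "y * pochhammer (- (y - 1)) k - (y + b + 1) * pochhammer (- y) k = - (real k + b + 1) * pochhammer (- y) k"
      using backward_diff_pochhammer[of y k] by (simp add: algebra_simps)
    have "?a' k * (y * pochhammer (- (y - 1)) k - (y + b + 1) * pochhammer (- y) k) =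
        - ((real k + b + 1) * ?a' k) * pochhammer (- y) k"
      unfolding basis by (simp add: algebra_simps)
    also have "\<dots> = - ((b + real n + 1) * ?a k) * pochhammer (- y) k"
      using k by (simp only: coeff atMost_iff)
    finally show "?a' k * (y * pochhammer (- (y - 1)) k - (y + b + 1) * pochhammer (- y) k) =
        - (b + real n + 1) * (?a k * pochhammer (- y) k)" by (simp only: minus_mult_left mult.assoc)
  qed
  finally show ?thesis
    unfolding R_uni_scaled_eq_sum_uni_coeff sum_distrib_left .
qed

lemma R_uni_scaled_lower:
  assumes s: "s > -1"
  shows "(s + 1 + y) * R_uni_scaled n (y + 1) s (b - 1) (h - 1) - (y + h) * R_uni_scaled n y s (b - 1) (h - 1) =
     - (h - s - real n - 1) * R_uni_scaled n y s b h"
proof -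
  define B where "B = uni_base n s (h - b)"
  let ?a = "uni_coeff n s b h" and ?a' = "uni_coeff n s (b - 1) (h - 1)"
  let ?\<phi> = "pochhammer (- y)"
  have B: "real (Suc k) * (s + real (Suc k)) * B (Suc k) = (real k - real n) * (real n - (h - b) + s + 1 + real k) * B k" for k
    unfolding B_def using s by (rule uni_base_rec)
  have a: "?a k = B k * pochhammer (b + 1 + real k) (n - k)" "?a' k = B k * pochhammer (b + real k) (n - k)" for k
    by (simp_all add: uni_coeff_eq_uni_base B_def)
  have coeff: "(real k + s + 1 - h) * ?a' k - real (Suc k) * (s + real (Suc k)) * ?a' (Suc k) =
      - (h - s - real n - 1) * ?a k" if "k \<le> n" for k
  proof (cases "k = n")
    case True
    then show ?thesis by (simp add: a uni_base_eq_0 B_def algebra_simps)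
  next
    case False
    define m where "m = n - k - 1"
    define E where "E = pochhammer (b + real k + 1) m"
    have nk: "n - k = Suc m" "n - Suc k = m" "real n = real k + real m + 1" using that False by (auto simp: m_def)
    have 1: "pochhammer (b + real k) (n - k) = (b + real k) * E" by (simp add: nk E_def pochhammer_rec)
    have 2: "pochhammer (b + 1 + real k) (n - k) = E * (b + real n)"
      by (simp add: nk E_def pochhammer_Suc algebra_simps)
    have 3: "pochhammer (b + real (Suc k)) (n - Suc k) = E" by (simp add: nk(2) E_def algebra_simps)
    have "(real k + s + 1 - h) * ?a' k - real (Suc k) * (s + real (Suc k)) * ?a' (Suc k) =
      (real k + s + 1 - h) * B k * (b + real k) * E - (real (Suc k) * (s + real (Suc k)) * B (Suc k)) * E"
      unfolding a 1 3 by simp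
    also have "\<dots> = - (h - s - real n - 1) * ?a k"
      unfolding a 2 B by (simp add: algebra_simps)
    finally show ?thesis .
  qed
  have "(s + 1 + y) * R_uni_scaled n (y + 1) s (b - 1) (h - 1) - (y + h) * R_uni_scaled n y s (b - 1) (h - 1) =
      (\<Sum>k\<le>n. ?a' k * ((s + 1 + y) * (pochhammer (- (y + 1)) k - ?\<phi> k) + (s + 1 - h) * ?\<phi> k))"
    unfolding R_uni_scaled_eq_sum_uni_coeff sum_distrib_left
    by (simp only: flip: sum_subtractf) (simp add: algebra_simps)
  also have "\<dots> = (\<Sum>k\<le>n. (real k + s + 1 - h) * ?a' k * ?\<phi> k)
      - (\<Sum>k\<le>n. (real k * (s + real k) * ?a' k) * ?\<phi> (k - 1))"
    unfolding forward_diff_pochhammer by (simp add: algebra_simps flip: sum_subtractf)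
  also have "(\<Sum>k\<le>n. (real k * (s + real k) * ?a' k) * ?\<phi> (k - 1)) =
      (\<Sum>k\<le>n. (real (Suc k) * (s + real (Suc k)) * ?a' (Suc k)) * ?\<phi> k)"
    by (rule sum_pred_shift) (simp_all add: uni_coeff_eq_uni_base uni_base_eq_0)
  also have "(\<Sum>k\<le>n. (real k + s + 1 - h) * ?a' k * ?\<phi> k) - \<dots> =
      (\<Sum>k\<le>n. ((real k + s + 1 - h) * ?a' k - real (Suc k) * (s + real (Suc k)) * ?a' (Suc k)) * ?\<phi> k)"
    by (simp only: left_diff_distrib flip: sum_subtractf)
  also have "\<dots> = (\<Sum>k\<le>n. - (h - s - real n - 1) * (?a k * ?\<phi> k))"
    by (intro sum.cong refl, subst coeff) (simp_all only: atMost_iff mult.assoc)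
  finally show ?thesis
    unfolding R_uni_scaled_eq_sum_uni_coeff sum_distrib_left .
qed

text \<open>
  On \<open>\<phi>\<^sub>k(y) = (-y)\<^sub>k\<close> the operator acts by \<open>\<phi>\<^sub>k \<mapsto> k (k - c) \<phi>\<^sub>k - k (s + k) (k + b) \<phi>\<^sub>k\<^sub>-\<^sub>1\<close> with
  \<open>c = h - b - s - 1\<close>, so the eigenvalue equation is the recurrence of the coefficients.
\<close>

lemma R_uni_scaled_difference_equation:
  assumes s: "s > -1"
  shows "(y + b + 1) * (s + 1 + y) * (R_uni_scaled n (y + 1) s b h - R_uni_scaled n y s b h)
      - (y + h) * y * (R_uni_scaled n y s b h - R_uni_scaled n (y - 1) s b h) =
     real n * (real n - (h - b - s - 1)) * R_uni_scaled n y s b h"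
proof -
  define B where "B = uni_base n s (h - b)"
  define c where "c = h - b - s - 1"
  let ?a = "uni_coeff n s b h"
  let ?\<phi> = "pochhammer (- y)"
  have B: "real (Suc k) * (s + real (Suc k)) * B (Suc k) = (real k - real n) * (real n - c + real k) * B k" for k
    unfolding B_def c_def uni_base_rec[OF s] by (simp add: algebra_simps)
  have a: "?a k = B k * pochhammer (b + 1 + real k) (n - k)" for k
    by (simp add: uni_coeff_eq_uni_base B_def)
  have coeff: "real (Suc k) * (s + real (Suc k)) * (real (Suc k) + b) * ?a (Suc k) =
      (real k - real n) * (real n - c + real k) * ?a k" if "k \<le> n" for k
  proof (cases "k = n")
    case True
    then show ?thesis by (simp add: a uni_base_eq_0 B_def)
  next
    case False
    then have "n - k = Suc (n - Suc k)" using that by simp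
    then have "pochhammer (b + 1 + real k) (n - k) = (real (Suc k) + b) * pochhammer (b + 1 + real (Suc k)) (n - Suc k)"
      by (simp add: pochhammer_rec algebra_simps)
    then have ak: "?a k = B k * ((real (Suc k) + b) * pochhammer (b + 1 + real (Suc k)) (n - Suc k))"
      by (simp add: a)
    have "real (Suc k) * (s + real (Suc k)) * (real (Suc k) + b) * ?a (Suc k) =
        (real (Suc k) * (s + real (Suc k)) * B (Suc k)) * ((real (Suc k) + b) * pochhammer (b + 1 + real (Suc k)) (n - Suc k))"
      by (simp only: a mult_ac)
    then show ?thesis unfolding B ak by (simp only: mult_ac)
  qed
  have basis: "(y + b + 1) * (s + 1 + y) * (pochhammer (- (y + 1)) k - ?\<phi> k) - (y + h) * y * (?\<phi> k - pochhammer (- (y - 1)) k) =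
      real k * (real k - c) * ?\<phi> k - real k * (s + real k) * (real k + b) * ?\<phi> (k - 1)" for k
  proof -
    have low: "real k * (y * ?\<phi> (k - 1)) = real k * ((real k - 1) * ?\<phi> (k - 1) - ?\<phi> k)"
    proof (cases k)
      case (Suc m)
      then show ?thesis by (simp add: pochhammer_Suc algebra_simps)
    qed simp
    have "(y + b + 1) * (s + 1 + y) * (pochhammer (- (y + 1)) k - ?\<phi> k) - (y + h) * y * (?\<phi> k - pochhammer (- (y - 1)) k) =
        (y + b + 1) * (real k * ?\<phi> k - real k * (s + real k) * ?\<phi> (k - 1)) - (y + h) * (real k * ?\<phi> k)"
      by (simp only: mult.assoc forward_diff_pochhammer backward_diff_pochhammer)
    also have "\<dots> = real k * (b + 1 - h) * ?\<phi> k - (s + real k) * (real k * (y * ?\<phi> (k - 1)))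
        - (s + real k) * (b + 1) * real k * ?\<phi> (k - 1)"
      by (simp add: algebra_simps)
    also have "\<dots> = real k * (real k - c) * ?\<phi> k - real k * (s + real k) * (real k + b) * ?\<phi> (k - 1)"
      unfolding low by (simp add: c_def algebra_simps)
    finally show ?thesis .
  qed
  have "(y + b + 1) * (s + 1 + y) * (R_uni_scaled n (y + 1) s b h - R_uni_scaled n y s b h)
      - (y + h) * y * (R_uni_scaled n y s b h - R_uni_scaled n (y - 1) s b h) =
      (\<Sum>k\<le>n. ?a k * ((y + b + 1) * (s + 1 + y) * (pochhammer (- (y + 1)) k - ?\<phi> k)
        - (y + h) * y * (?\<phi> k - pochhammer (- (y - 1)) k)))"
    unfolding R_uni_scaled_eq_sum_uni_coeff
    by (simp only: sum_distrib_left right_diff_distrib mult_ac flip: sum_subtractf)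
  also have "\<dots> = (\<Sum>k\<le>n. real k * (real k - c) * ?a k * ?\<phi> k)
      - (\<Sum>k\<le>n. (real k * (s + real k) * (real k + b) * ?a k) * ?\<phi> (k - 1))"
    unfolding basis by (simp only: right_diff_distrib mult_ac flip: sum_subtractf)
  also have "(\<Sum>k\<le>n. (real k * (s + real k) * (real k + b) * ?a k) * ?\<phi> (k - 1)) =
      (\<Sum>k\<le>n. (real (Suc k) * (s + real (Suc k)) * (real (Suc k) + b) * ?a (Suc k)) * ?\<phi> k)"
    by (rule sum_pred_shift) (simp_all add: uni_coeff_eq_uni_base uni_base_eq_0)
  also have "\<dots> = (\<Sum>k\<le>n. ((real k - real n) * (real n - c + real k) * ?a k) * ?\<phi> k)"
    by (intro sum.cong refl) (simp only: coeff atMost_iff)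
  also have "(\<Sum>k\<le>n. real k * (real k - c) * ?a k * ?\<phi> k) - \<dots> =
      (\<Sum>k\<le>n. real n * (real n - c) * (?a k * ?\<phi> k))"
    unfolding sum_subtractf[symmetric] by (intro sum.cong refl) (simp add: algebra_simps)
  finally show ?thesis
    unfolding R_uni_scaled_eq_sum_uni_coeff sum_distrib_left c_def .
qed

section \<open>The difference operator\<close>

text \<open>
  The operator \<open>\<Sum> x\<^sub>j (\<sigma>\<^sub>i + 1 + x\<^sub>i) f(x + e\<^sub>i - e\<^sub>j)\<close>.  The nested update makes the terms with
  \<open>i = j\<close> evaluate \<open>f\<close> at \<open>x\<close> itself.
\<close>

definition exchange :: "nat \<Rightarrow> (nat \<Rightarrow> real) \<Rightarrow> ((nat \<Rightarrow> real) \<Rightarrow> real) \<Rightarrow> (nat \<Rightarrow> real) \<Rightarrow> real" where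
  "exchange d \<sigma> f x = (\<Sum>i=1..d. \<Sum>j=1..d.
     x j * (\<sigma> i + 1 + x i) * f ((x(i := x i + 1))(j := (x(i := x i + 1)) j - 1)))"

text \<open>The operator \<open>\<Sum> (\<sigma>\<^sub>i + 1 + x\<^sub>i) f(x + e\<^sub>i)\<close>.\<close>

definition raise :: "nat \<Rightarrow> (nat \<Rightarrow> real) \<Rightarrow> ((nat \<Rightarrow> real) \<Rightarrow> real) \<Rightarrow> (nat \<Rightarrow> real) \<Rightarrow> real" where
  "raise d \<sigma> f x = (\<Sum>i=1..d. (\<sigma> i + 1 + x i) * f (x(i := x i + 1)))"

text \<open>The operator \<open>\<Sum> x\<^sub>j f(x - e\<^sub>j)\<close>.\<close>

definition lower :: "nat \<Rightarrow> ((nat \<Rightarrow> real) \<Rightarrow> real) \<Rightarrow> (nat \<Rightarrow> real) \<Rightarrow> real" where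
  "lower d f x = (\<Sum>j=1..d. x j * f (x(j := x j - 1)))"

text \<open>
  The coefficient of \<open>f x\<close> left over when \<open>D\<close> is written in the three operators above; \<open>t\<close> is
  \<open>|x|\<close> and \<open>N\<close> is \<open>|\<sigma>| + d\<close>.
\<close>

definition zero_order :: "real \<Rightarrow> real \<Rightarrow> real \<Rightarrow> real \<Rightarrow> real" where
  "zero_order N \<beta> \<gamma> t = t\<^sup>2 + t * (\<gamma> + \<beta> + 1) + N * (1 + \<beta>)"

text \<open>
  Terms \<open>x\<^sub>i f(x + e\<^sub>i)\<close> not contained in \<open>raise\<close> cancel, since
  \<open>- (\<gamma> - N) + (\<gamma> - \<beta> - N - 1) + (1 + \<beta>) = 0\<close> with \<open>N = |\<sigma>| + d\<close>.
\<close>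

lemma D_op_eq_ladder:
  fixes d :: nat and x :: "nat \<Rightarrow> real"
  defines "t \<equiv> head_sum x d"
  shows "D_op d \<sigma> \<beta> \<gamma> f x =
     exchange d \<sigma> f x - (t + \<beta> + 1) * raise d \<sigma> f x - (t + \<gamma>) * lower d f x
     + zero_order (vec_sum d \<sigma> + real d) \<beta> \<gamma> t * f x"
proof -
  define N where "N = vec_sum d \<sigma> + real d"
  define s where "s i = \<sigma> i + 1 + x i" for i
  define A where "A i = f (x(i := x i + 1))" for i
  define B where "B j = f (x(j := x j - 1))" for j
  define S where "S i j = f ((x(i := x i + 1))(j := (x(i := x i + 1)) j - 1))" for i j
  define XA where "XA = (\<Sum>i=1..d. x i * A i)"
  define RA where "RA = (\<Sum>i=1..d. s i * A i)"
  define LB where "LB = (\<Sum>j=1..d. x j * B j)"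
  have t: "t = (\<Sum>i=1..d. x i)" by (simp add: t_def head_sum_def)
  have sum_s: "(\<Sum>i=1..d. s i) = N + t"
    by (simp add: s_def N_def t vec_sum_def sum.distrib)
  have Sii: "S i i = f x" for i by (simp add: S_def)
  have "(\<Sum>i=1..d. \<Sum>j=1..d. x j * (\<sigma> i + 1 + x i + (if i = j then \<gamma> - vec_sum d \<sigma> - real d else 0))
            * forward_diff i (backward_diff j f) x) =
      (\<Sum>i=1..d. \<Sum>j=1..d. x j * s i * (A i - S i j - f x + B j)
          + (if i = j then (\<gamma> - N) * x i * (A i - 2 * f x + B i) else 0))"
    by (intro sum.cong refl)
       (auto simp: forward_diff_def backward_diff_def s_def N_def A_def B_def S_def algebra_simps)
  also have "\<dots> = (\<Sum>i=1..d. \<Sum>j=1..d. x j * s i * (A i - S i j - f x + B j))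
      + (\<Sum>i=1..d. (\<gamma> - N) * x i * (A i - 2 * f x + B i))"
    by (simp add: sum.distrib sum.delta)
  also have "(\<Sum>i=1..d. \<Sum>j=1..d. x j * s i * (A i - S i j - f x + B j)) =
      (\<Sum>i=1..d. \<Sum>j=1..d. (s i * A i) * x j) - (\<Sum>i=1..d. \<Sum>j=1..d. x j * s i * S i j)
      - f x * (\<Sum>i=1..d. \<Sum>j=1..d. s i * x j) + (\<Sum>i=1..d. \<Sum>j=1..d. s i * (x j * B j))"
    by (simp add: algebra_simps sum.distrib sum_subtractf sum_distrib_left)
  also have "\<dots> = RA * t - exchange d \<sigma> f x - f x * ((N + t) * t) + (N + t) * LB"
  proof -
    have "(\<Sum>i=1..d. \<Sum>j=1..d. (s i * A i) * x j) = RA * t"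
      "(\<Sum>i=1..d. \<Sum>j=1..d. s i * x j) = (N + t) * t"
      "(\<Sum>i=1..d. \<Sum>j=1..d. s i * (x j * B j)) = (N + t) * LB"
      by (simp_all only: RA_def LB_def sum_product flip: sum_s) (simp_all only: t sum_product)
    then show ?thesis by (simp add: exchange_def s_def S_def)
  qed
  also have "(\<Sum>i=1..d. (\<gamma> - N) * x i * (A i - 2 * f x + B i)) = (\<gamma> - N) * (XA - 2 * f x * t + LB)"
    by (simp add: XA_def LB_def t algebra_simps sum.distrib sum_subtractf sum_distrib_left)
  finally have second: "(\<Sum>i=1..d. \<Sum>j=1..d. x j * (\<sigma> i + 1 + x i + (if i = j then \<gamma> - vec_sum d \<sigma> - real d else 0))
            * forward_diff i (backward_diff j f) x) =
      RA * t - exchange d \<sigma> f x - f x * ((N + t) * t) + (N + t) * LB + (\<gamma> - N) * (XA - 2 * f x * t + LB)" .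
  have "(\<Sum>i=1..d. (x i * (\<gamma> - \<beta> - vec_sum d \<sigma> - real d - 1) - (1 + \<beta>) * (1 + \<sigma> i)) * forward_diff i f x) =
      (\<Sum>i=1..d. (\<gamma> - \<beta> - N - 1 + (1 + \<beta>)) * (x i * A i) - (1 + \<beta>) * (s i * A i)
         - (\<gamma> - \<beta> - N - 1) * f x * x i + (1 + \<beta>) * f x * (\<sigma> i + 1))"
    by (intro sum.cong refl) (simp add: forward_diff_def A_def s_def N_def algebra_simps)
  also have "\<dots> = (\<gamma> - N) * XA - (1 + \<beta>) * RA - (\<gamma> - \<beta> - N - 1) * f x * t + (1 + \<beta>) * f x * N"
    unfolding sum.distrib sum_subtractf sum_distrib_left[symmetric] XA_def RA_def t
    by (simp add: N_def vec_sum_def)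
  finally have first: "(\<Sum>i=1..d. (x i * (\<gamma> - \<beta> - vec_sum d \<sigma> - real d - 1) - (1 + \<beta>) * (1 + \<sigma> i)) * forward_diff i f x) =
      (\<gamma> - N) * XA - (1 + \<beta>) * RA - (\<gamma> - \<beta> - N - 1) * f x * t + (1 + \<beta>) * f x * N" .
  have "raise d \<sigma> f x = RA" "lower d f x = LB"
    by (simp_all add: raise_def lower_def RA_def LB_def s_def A_def B_def)
  then show ?thesis
    unfolding D_op_def second first N_def[symmetric] zero_order_def power2_eq_square
    by (simp add: algebra_simps)
qed

lemma head_sum_upd:
  "head_sum (x(i := v)) d = (if i \<in> {1..d} then head_sum x d - x i + v else head_sum x d)"
  for x :: "nat \<Rightarrow> 'a::ab_group_add"
proof (cases "i \<in> {1..d}")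
  case True
  have "(\<Sum>j=1..d. (x(i := v)) j) = v + (\<Sum>j\<in>{1..d} - {i}. x j)"
    using True by (subst sum.remove[of _ i]) (auto intro!: sum.cong)
  moreover have "(\<Sum>j=1..d. x j) = x i + (\<Sum>j\<in>{1..d} - {i}. x j)"
    using True by (intro sum.remove) auto
  ultimately show ?thesis using True by (simp add: head_sum_def)
next
  case False
  then have "head_sum (x(i := v)) d = head_sum x d" by (intro head_sum_cong) auto
  with False show ?thesis by (simp only: if_False)
qed

text \<open>
  If \<open>f\<close> is a function of \<open>x\<^sub>d\<^sub>+\<^sub>1\<close> and \<open>x\<^sub>1 + \<dots> + x\<^sub>d\<close> times a function \<open>P\<close> of \<open>x\<^sub>1, \<dots>, x\<^sub>d\<close>, then the
  operators in \<open>d + 1\<close> variables act on \<open>P\<close> through those in \<open>d\<close> variables.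
\<close>

lemma ladder_product:
  fixes d :: nat and \<sigma> :: "nat \<Rightarrow> real" and g :: "real \<Rightarrow> real \<Rightarrow> real" and P :: "(nat \<Rightarrow> real) \<Rightarrow> real" and x :: "nat \<Rightarrow> real"
  assumes P: "\<And>x v. P (x(Suc d := v)) = P x"
  defines "f \<equiv> \<lambda>x. g (head_sum x d) (x (Suc d)) * P x"
  defines "X \<equiv> head_sum x d" and "y \<equiv> x (Suc d)" and "s \<equiv> \<sigma> (Suc d)"
  shows "raise (Suc d) \<sigma> f x = g (X + 1) y * raise d \<sigma> P x + (s + 1 + y) * g X (y + 1) * P x"
    and "lower (Suc d) f x = g (X - 1) y * lower d P x + y * g X (y - 1) * P x"
    and "exchange (Suc d) \<sigma> f x = g X y * exchange d \<sigma> P x + y * g (X + 1) (y - 1) * raise d \<sigma> P x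
           + (s + 1 + y) * g (X - 1) (y + 1) * lower d P x + y * (s + 1 + y) * g X y * P x"
proof -
  have P': "P ((z(Suc d := v))(j := w)) = P (z(j := w))" if "j \<noteq> Suc d" for z v j w
    using that P by (simp add: fun_upd_twist)
  have ind: "(\<Sum>i=1..Suc d. u i) = (\<Sum>i=1..d. u i) + u (Suc d)" for u :: "nat \<Rightarrow> real" by simp
  have old: "i \<noteq> Suc d" "Suc d \<noteq> i" if "i \<in> {1..d}" for i using that by auto
  have r: "(\<Sum>i=1..d. (\<sigma> i + 1 + x i) * f (x(i := x i + 1))) = g (X + 1) y * raise d \<sigma> P x"
    unfolding raise_def sum_distrib_left
    by (intro sum.cong refl) (use old in \<open>auto simp: f_def head_sum_upd X_def y_def algebra_simps\<close>)
  have l: "(\<Sum>j=1..d. x j * f (x(j := x j - 1))) = g (X - 1) y * lower d P x"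
    unfolding lower_def sum_distrib_left
    by (intro sum.cong refl) (use old in \<open>auto simp: f_def head_sum_upd X_def y_def algebra_simps\<close>)
  show "raise (Suc d) \<sigma> f x = g (X + 1) y * raise d \<sigma> P x + (s + 1 + y) * g X (y + 1) * P x"
    unfolding raise_def[of "Suc d"] ind r by (simp add: f_def head_sum_upd P X_def y_def s_def)
  show "lower (Suc d) f x = g (X - 1) y * lower d P x + y * g X (y - 1) * P x"
    unfolding lower_def[of "Suc d"] ind l by (simp add: f_def head_sum_upd P X_def y_def)
  have e: "(\<Sum>i=1..d. \<Sum>j=1..d. x j * (\<sigma> i + 1 + x i) * f ((x(i := x i + 1))(j := (x(i := x i + 1)) j - 1))) =
      g X y * exchange d \<sigma> P x"
    unfolding exchange_def sum_distrib_left
    by (intro sum.cong refl) (use old in \<open>auto simp: f_def head_sum_upd X_def y_def\<close>)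
  have er: "(\<Sum>i=1..d. x (Suc d) * (\<sigma> i + 1 + x i) *
        f ((x(i := x i + 1))(Suc d := (x(i := x i + 1)) (Suc d) - 1))) = y * g (X + 1) (y - 1) * raise d \<sigma> P x"
    unfolding raise_def sum_distrib_left
    by (intro sum.cong refl) (use old in \<open>auto simp: f_def head_sum_upd X_def y_def P algebra_simps\<close>)
  have el: "(\<Sum>j=1..d. x j * (\<sigma> (Suc d) + 1 + x (Suc d)) *
        f ((x(Suc d := x (Suc d) + 1))(j := (x(Suc d := x (Suc d) + 1)) j - 1))) =
      (s + 1 + y) * g (X - 1) (y + 1) * lower d P x"
    unfolding lower_def sum_distrib_left
    by (intro sum.cong refl) (use old in \<open>auto simp: f_def head_sum_upd X_def y_def s_def P' algebra_simps\<close>)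
  show "exchange (Suc d) \<sigma> f x = g X y * exchange d \<sigma> P x + y * g (X + 1) (y - 1) * raise d \<sigma> P x
           + (s + 1 + y) * g (X - 1) (y + 1) * lower d P x + y * (s + 1 + y) * g X y * P x"
    unfolding exchange_def[of "Suc d"] ind sum.distrib e er el
    by (simp add: f_def X_def y_def s_def)
qed

lemma zero_order_Suc:
  fixes N s \<beta> \<gamma> X y :: real and m n :: real
  shows "zero_order (N + s + 1) \<beta> \<gamma> (X + y)
      - zero_order N (\<beta> + n) (\<gamma> - s - n - 1) X
      - ((m + n) * (- (m + n) + \<gamma> - \<beta> - (N + s + 1)) - m * (- m + (\<gamma> - s - n - 1) - (\<beta> + n) - N)) =
     y\<^sup>2 + y * (\<gamma> + X + \<beta> + X + 1) + (s + 1) * (\<beta> + X + 1) + n\<^sup>2 - n * (\<gamma> - \<beta> - s - 1)"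
  unfolding zero_order_def power2_eq_square by (simp add: algebra_simps)

text \<open>
  By \<open>ladder_product\<close> and the contiguous relations, the coefficients of \<open>raise d \<sigma> P x\<close>,
  \<open>lower d P x\<close> and \<open>P x\<close> in \<open>D f\<close> are those of the \<open>d\<close>-variable operator with the shifted
  parameters, multiplied by \<open>g X y\<close>, up to the change of eigenvalue.
\<close>

lemma R_multi_difference_equation:
  assumes "\<And>i. i \<in> {1..d} \<Longrightarrow> \<sigma> i > -1"
  shows "D_op d \<sigma> \<beta> \<gamma> (R_multi d \<sigma> \<beta> \<gamma> \<nu>) x =
     eigval d \<sigma> \<beta> \<gamma> (vec_sum d \<nu>) * R_multi d \<sigma> \<beta> \<gamma> \<nu> x"
  using assms
proof (induction d arbitrary: \<beta> \<gamma>)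
  case 0
  then show ?case by (simp add: D_op_def eigval_def)
next
  case (Suc d \<beta> \<gamma>)
  define n where "n = \<nu> (Suc d)"
  define s where "s = \<sigma> (Suc d)"
  define y where "y = x (Suc d)"
  define X where "X = head_sum x d"
  define N where "N = vec_sum d \<sigma> + real d"
  define m where "m = real (vec_sum d \<nu>)"
  define \<beta>' where "\<beta>' = \<beta> + real n"
  define \<gamma>' where "\<gamma>' = \<gamma> - s - real n - 1"
  define g where "g X y = R_uni_scaled n y s (\<beta> + X) (\<gamma> + X)" for X y
  define P where "P = R_multi d \<sigma> \<beta>' \<gamma>' \<nu>"
  define f where "f x = g (head_sum x d) (x (Suc d)) * P x" for x
  define lam where "lam = (m + real n) * (- (m + real n) + \<gamma> - \<beta> - (N + s + 1))"
  define lam' where "lam' = m * (- m + \<gamma>' - \<beta>' - N)"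
  have s: "s > -1" using Suc.prems by (simp add: s_def)
  have R: "R_multi (Suc d) \<sigma> \<beta> \<gamma> \<nu> = f"
    by (intro ext) (simp add: R_multi_Suc f_def g_def P_def \<beta>'_def \<gamma>'_def n_def s_def)
  have P: "P (x(Suc d := v)) = P x" for x v
    unfolding P_def by (intro R_multi_cong) auto
  have "D_op d \<sigma> \<beta>' \<gamma>' P x = lam' * P x"
    using Suc.IH[of \<beta>' \<gamma>'] Suc.prems by (simp add: P_def lam'_def eigval_def m_def N_def algebra_simps)
  then have IH: "exchange d \<sigma> P x = (X + \<beta>' + 1) * raise d \<sigma> P x + (X + \<gamma>') * lower d P x
      + (lam' - zero_order N \<beta>' \<gamma>' X) * P x"
    unfolding D_op_eq_ladder N_def X_def by (simp add: algebra_simps)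
  have cA: "y * g (X + 1) (y - 1) - (X + y + \<beta> + 1) * g (X + 1) y = - (X + \<beta>' + 1) * g X y"
    using R_uni_scaled_raise[of y n s "\<beta> + X" "\<gamma> + X"] by (simp add: g_def \<beta>'_def algebra_simps)
  have cB: "(s + 1 + y) * g (X - 1) (y + 1) - (X + y + \<gamma>) * g (X - 1) y = - (X + \<gamma>') * g X y"
    using R_uni_scaled_lower[OF s, of y n "\<beta> + X" "\<gamma> + X"] by (simp add: g_def \<gamma>'_def algebra_simps)
  have cC: "y * (s + 1 + y) * g X y - (X + y + \<beta> + 1) * (s + 1 + y) * g X (y + 1)
      - (X + y + \<gamma>) * y * g X (y - 1) + zero_order (N + s + 1) \<beta> \<gamma> (X + y) * g X y =
      (lam - lam' + zero_order N \<beta>' \<gamma>' X) * g X y"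
  proof -
    have z: "zero_order (N + s + 1) \<beta> \<gamma> (X + y) = (lam - lam' + zero_order N \<beta>' \<gamma>' X)
        + (y\<^sup>2 + y * (\<gamma> + X + \<beta> + X + 1) + (s + 1) * (\<beta> + X + 1) + (real n)\<^sup>2 - real n * (\<gamma> - \<beta> - s - 1))"
      using zero_order_Suc[of N s \<beta> \<gamma> X y "real n" m] by (simp add: lam_def lam'_def \<beta>'_def \<gamma>'_def)
    have "(y + (\<beta> + X) + 1) * (s + 1 + y) * (g X (y + 1) - g X y) - (y + (\<gamma> + X)) * y * (g X y - g X (y - 1)) =
        real n * (real n - (\<gamma> + X - (\<beta> + X) - s - 1)) * g X y"
      unfolding g_def by (rule R_uni_scaled_difference_equation[OF s])
    then show ?thesis unfolding z by (simp add: algebra_simps power2_eq_square)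
  qed
  have "D_op (Suc d) \<sigma> \<beta> \<gamma> f x = exchange (Suc d) \<sigma> f x - (X + y + \<beta> + 1) * raise (Suc d) \<sigma> f x
      - (X + y + \<gamma>) * lower (Suc d) f x + zero_order (N + s + 1) \<beta> \<gamma> (X + y) * f x"
    unfolding D_op_eq_ladder head_sum_Suc vec_sum_Suc X_def y_def N_def s_def by (simp add: add_ac)
  also have "\<dots> = g X y * exchange d \<sigma> P x
      + (y * g (X + 1) (y - 1) - (X + y + \<beta> + 1) * g (X + 1) y) * raise d \<sigma> P x
      + ((s + 1 + y) * g (X - 1) (y + 1) - (X + y + \<gamma>) * g (X - 1) y) * lower d P x
      + (y * (s + 1 + y) * g X y - (X + y + \<beta> + 1) * (s + 1 + y) * g X (y + 1)
      - (X + y + \<gamma>) * y * g X (y - 1) + zero_order (N + s + 1) \<beta> \<gamma> (X + y) * g X y) * P x"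
    using ladder_product(1)[where P = P and d = d and g = g and x = x and \<sigma> = \<sigma>, OF P]
      ladder_product(2)[where P = P and d = d and g = g and x = x, OF P]
      ladder_product(3)[where P = P and d = d and g = g and x = x and \<sigma> = \<sigma>, OF P]
    unfolding f_def[abs_def] X_def[symmetric] y_def[symmetric] s_def[symmetric]
    by (simp add: algebra_simps)
  also have "\<dots> = lam * (g X y * P x)"
    unfolding IH cA cB cC by (simp add: algebra_simps)
  also have "g X y * P x = f x" by (simp add: f_def X_def y_def)
  also have "lam = eigval (Suc d) \<sigma> \<beta> \<gamma> (vec_sum (Suc d) \<nu>)"
    by (simp add: lam_def eigval_def vec_sum_Suc m_def n_def N_def s_def algebra_simps)
  finally show ?case unfolding R .
qed

section \<open>Polynomiality\<close>

text \<open>Repeated exponents are allowed here, unlike in the definition.\<close>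

lemma is_polynomialI:
  assumes "finite I" and "\<And>x. f x = (\<Sum>k\<in>I. c k * (\<Prod>i=1..d. x i ^ e k i))"
  shows "is_polynomial d f"
proof -
  define c' where "c' m = (\<Sum>k | k \<in> I \<and> e k = m. c k)" for m
  have "f x = (\<Sum>m\<in>e ` I. c' m * (\<Prod>i=1..d. x i ^ m i))" for x
  proof -
    have "f x = (\<Sum>m\<in>e ` I. \<Sum>k | k \<in> I \<and> e k = m. c k * (\<Prod>i=1..d. x i ^ e k i))"
      unfolding assms(2) by (rule sum.image_gen[OF assms(1)])
    also have "\<dots> = (\<Sum>m\<in>e ` I. c' m * (\<Prod>i=1..d. x i ^ m i))"
      unfolding c'_def sum_distrib_right by (intro sum.cong) auto
    finally show ?thesis .
  qed
  then show ?thesis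
    unfolding is_polynomial_def using assms(1) by (intro exI[of _ "e ` I"] exI[of _ c']) auto
qed

lemma is_polynomial_const [intro]: "is_polynomial d (\<lambda>x. c)"
  by (rule is_polynomialI[where I = "{0::nat}" and c = "\<lambda>_. c" and e = "\<lambda>_ _. 0"]) auto

lemma is_polynomial_component: "i \<in> {1..d} \<Longrightarrow> is_polynomial d (\<lambda>x. x i)"
proof (rule is_polynomialI[where I = "{0::nat}" and c = "\<lambda>_. 1" and e = "\<lambda>_ j. if j = i then 1 else 0"])
  fix x :: "nat \<Rightarrow> real"
  assume i: "i \<in> {1..d}"
  have "(\<Prod>j=1..d. x j ^ (if j = i then 1 else 0)) = (\<Prod>j=1..d. if j = i then x i else 1)"
    by (intro prod.cong) auto
  also have "\<dots> = x i" using i by (simp add: prod.delta)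
  finally show "x i = (\<Sum>k\<in>{0::nat}. 1 * (\<Prod>j=1..d. x j ^ (if j = i then 1 else 0)))" by simp
qed simp

lemma is_polynomial_add [intro]:
  assumes "is_polynomial d f" "is_polynomial d g"
  shows "is_polynomial d (\<lambda>x. f x + g x)"
proof -
  obtain M b where M: "finite M" "\<And>x. f x = (\<Sum>m\<in>M. b m * (\<Prod>i=1..d. x i ^ m i))"
    using assms(1) unfolding is_polynomial_def by blast
  obtain L c where L: "finite L" "\<And>x. g x = (\<Sum>m\<in>L. c m * (\<Prod>i=1..d. x i ^ m i))"
    using assms(2) unfolding is_polynomial_def by blast
  show ?thesis
    by (rule is_polynomialI[where I = "M <+> L" and c = "case_sum b c" and e = "case_sum id id"])
       (use M(1) L(1) in \<open>auto simp: M(2) L(2) sum.Plus\<close>)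
qed

lemma is_polynomial_mult [intro]:
  assumes "is_polynomial d f" "is_polynomial d g"
  shows "is_polynomial d (\<lambda>x. f x * g x)"
proof -
  obtain M b where M: "finite M" "\<And>x. f x = (\<Sum>m\<in>M. b m * (\<Prod>i=1..d. x i ^ m i))"
    using assms(1) unfolding is_polynomial_def by blast
  obtain L c where L: "finite L" "\<And>x. g x = (\<Sum>m\<in>L. c m * (\<Prod>i=1..d. x i ^ m i))"
    using assms(2) unfolding is_polynomial_def by blast
  show ?thesis
  proof (rule is_polynomialI[where I = "M \<times> L" and c = "\<lambda>(m, l). b m * c l" and e = "\<lambda>(m, l) i. m i + l i"])
    show "f x * g x = (\<Sum>k\<in>M \<times> L. (case k of (m, l) \<Rightarrow> b m * c l)
        * (\<Prod>i=1..d. x i ^ (case k of (m, l) \<Rightarrow> \<lambda>i. m i + l i) i))" for x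
      unfolding M(2) L(2) sum_product sum.cartesian_product
      by (intro sum.cong refl) (auto simp: power_add prod.distrib)
  qed (use M(1) L(1) in auto)
qed

lemma is_polynomial_sum [intro]:
  "(\<And>k. k \<in> I \<Longrightarrow> is_polynomial d (f k)) \<Longrightarrow> is_polynomial d (\<lambda>x. \<Sum>k\<in>I. f k x)"
  by (induction I rule: infinite_finite_induct) auto

lemma is_polynomial_prod [intro]:
  "(\<And>k. k \<in> I \<Longrightarrow> is_polynomial d (f k)) \<Longrightarrow> is_polynomial d (\<lambda>x. \<Prod>k\<in>I. f k x)"
  by (induction I rule: infinite_finite_induct) auto

lemma is_polynomial_pochhammer [intro]:
  "is_polynomial d f \<Longrightarrow> is_polynomial d (\<lambda>x. pochhammer (f x) k)"
  unfolding pochhammer_prod by (rule is_polynomial_prod, rule is_polynomial_add) auto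

lemma is_polynomial_uminus [intro]: "is_polynomial d f \<Longrightarrow> is_polynomial d (\<lambda>x. - f x)"
  using is_polynomial_mult[OF is_polynomial_const[of d "-1"]] by simp

text \<open>
  \<open>\<alpha>\<^sub>3\<^sub>,\<^sub>j - \<alpha>\<^sub>2\<^sub>,\<^sub>j\<close> is constant in \<open>x\<close>, so \<open>x\<close> enters the coefficients only through Pochhammer factors.
\<close>

lemma is_polynomial_R_multi: "is_polynomial d (R_multi d \<sigma> \<beta> \<gamma> \<nu>)"
proof -
  have "is_polynomial d (\<lambda>x. R_uni_scaled (\<nu> j) (x j) (\<sigma> j) (alpha2 d \<beta> \<nu> x j) (alpha3 d \<sigma> \<gamma> \<nu> x j))"
    if j: "j \<in> {1..d}" for j
  proof -
    have comp: "is_polynomial d (\<lambda>x. x j)" using j by (rule is_polynomial_component)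
    have "is_polynomial d (\<lambda>x. head_sum x (j - 1))"
      unfolding head_sum_def using j by (intro is_polynomial_sum is_polynomial_component) auto
    then have "is_polynomial d (\<lambda>x. alpha2 d \<beta> \<nu> x j)"
      unfolding alpha2_def by (intro is_polynomial_add is_polynomial_const)
    moreover have "uni_coeff (\<nu> j) (\<sigma> j) (alpha2 d \<beta> \<nu> x j) (alpha3 d \<sigma> \<gamma> \<nu> x j) k =
        uni_base (\<nu> j) (\<sigma> j) (alpha32 d \<sigma> \<beta> \<gamma> \<nu> j) k * pochhammer (alpha2 d \<beta> \<nu> x j + 1 + real k) (\<nu> j - k)" for x k
      by (simp add: uni_coeff_eq_uni_base flip: alpha32_eq)
    ultimately show ?thesis
      unfolding R_uni_scaled_eq_sum_uni_coeff using comp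
      by (simp only:) (intro is_polynomial_sum is_polynomial_mult is_polynomial_pochhammer is_polynomial_add
          is_polynomial_const is_polynomial_uminus)
  qed
  then show ?thesis unfolding R_multi_def[abs_def] by (intro is_polynomial_prod)
qed

section \<open>Admissible indices and positive weights\<close>

text \<open>
  Positivity of the weight allows \<open>\<beta>\<close> and \<open>\<gamma>\<close> below \<open>-1\<close> only if both lie strictly between the same
  two consecutive integers.  This is excluded once \<open>\<gamma> - \<beta> > 1\<close>.
\<close>

lemma positive_weight_imp_parameter_gt:
  fixes \<beta> \<gamma> :: real
  assumes "\<And>k::nat. k \<ge> 1 \<Longrightarrow> (real k + \<beta>) / (real k + \<gamma>) > 0" and "\<gamma> - \<beta> > 1"
  shows "\<beta> > -1"
proof (rule ccontr)
  assume "\<not> \<beta> > -1"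
  \<comment> \<open>For this \<open>k\<close>, \<open>-1 < k + \<beta> \<le> 0\<close> and hence \<open>k + \<gamma> > 0\<close>.\<close>
  define k where "k = nat \<lfloor>- \<beta>\<rfloor>"
  have "real k = of_int \<lfloor>- \<beta>\<rfloor>" and "k \<ge> 1"
    using \<open>\<not> \<beta> > -1\<close> by (simp_all add: k_def le_nat_iff le_floor_iff)
  then have "real k + \<beta> \<le> 0" "real k + \<beta> > -1" by linarith+
  then have "(real k + \<beta>) / (real k + \<gamma>) \<le> 0"
    using assms(2) by (intro divide_nonpos_pos) linarith+
  then show False using assms(1)[OF \<open>k \<ge> 1\<close>] by linarith
qed

theorem theorem5p2:
  fixes d :: nat and \<sigma> :: "nat \<Rightarrow> real" and \<beta> \<gamma> :: real
  assumes "d > 1"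
    and "\<And>i. i \<in> {1..d} \<Longrightarrow> \<sigma> i > -1"
    and "\<And>k::nat. k \<ge> 1 \<Longrightarrow> (real k + \<beta>) / (real k + \<gamma>) > 0"
  shows
    "(\<forall>\<nu>. admissible d \<sigma> \<beta> \<gamma> \<nu> \<longrightarrow>
        is_polynomial d (R_multi d \<sigma> \<beta> \<gamma> \<nu>)
      \<and> (\<forall>x. (\<forall>j\<in>{1..d}. pochhammer (alpha2 d \<beta> \<nu> x j + 1) (\<nu> j) \<noteq> 0) \<longrightarrow>
            R_multi d \<sigma> \<beta> \<gamma> \<nu> x =
              (\<Prod>j=1..d. pochhammer (alpha2 d \<beta> \<nu> x j + 1) (\<nu> j)
                 * R_uni (\<nu> j) (x j) (\<sigma> j) (alpha2 d \<beta> \<nu> x j) (alpha3 d \<sigma> \<gamma> \<nu> x j)))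
      \<and> (\<forall>x. D_op d \<sigma> \<beta> \<gamma> (R_multi d \<sigma> \<beta> \<gamma> \<nu>) x
              = eigval d \<sigma> \<beta> \<gamma> (vec_sum d \<nu>) * R_multi d \<sigma> \<beta> \<gamma> \<nu> x))
   \<and> (\<forall>\<nu> \<mu>. admissible d \<sigma> \<beta> \<gamma> \<nu> \<longrightarrow> admissible d \<sigma> \<beta> \<gamma> \<mu> \<longrightarrow>
        ((\<lambda>x. R_multi d \<sigma> \<beta> \<gamma> \<nu> (real_vec x) * R_multi d \<sigma> \<beta> \<gamma> \<mu> (real_vec x) * weight d \<sigma> \<beta> \<gamma> x)
           has_sum (if \<nu> = \<mu> then sq_norm d \<sigma> \<beta> \<gamma> \<nu> else 0)) (multi_indices d))"
proof (intro conjI allI impI)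
  fix \<nu> assume "admissible d \<sigma> \<beta> \<gamma> \<nu>"
  show "is_polynomial d (R_multi d \<sigma> \<beta> \<gamma> \<nu>)"
    by (rule is_polynomial_R_multi)
  show "D_op d \<sigma> \<beta> \<gamma> (R_multi d \<sigma> \<beta> \<gamma> \<nu>) x = eigval d \<sigma> \<beta> \<gamma> (vec_sum d \<nu>) * R_multi d \<sigma> \<beta> \<gamma> \<nu> x" for x
    using assms(2) by (rule R_multi_difference_equation)
  show "R_multi d \<sigma> \<beta> \<gamma> \<nu> x =
      (\<Prod>j=1..d. pochhammer (alpha2 d \<beta> \<nu> x j + 1) (\<nu> j)
         * R_uni (\<nu> j) (x j) (\<sigma> j) (alpha2 d \<beta> \<nu> x j) (alpha3 d \<sigma> \<gamma> \<nu> x j))"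
    if "\<forall>j\<in>{1..d}. pochhammer (alpha2 d \<beta> \<nu> x j + 1) (\<nu> j) \<noteq> 0" for x
    unfolding R_multi_def using that by (intro prod.cong refl R_uni_scaled_eq) blast
next
  fix \<nu> \<mu> assume "admissible d \<sigma> \<beta> \<gamma> \<nu>" and "admissible d \<sigma> \<beta> \<gamma> \<mu>"
  then have \<nu>: "\<nu> \<in> multi_indices d" "2 * real (vec_sum d \<nu>) < \<gamma> - vec_sum d \<sigma> - \<beta> - real d - 1"
    and \<mu>: "\<mu> \<in> multi_indices d" "2 * real (vec_sum d \<mu>) < \<gamma> - vec_sum d \<sigma> - \<beta> - real d - 1"
    by (simp_all add: admissible_def)
  have "vec_sum d \<sigma> + real d \<ge> 0" using assms(2) by (rule vec_sum_gt)
  then have "\<gamma> - \<beta> > 1" using \<nu>(2) by linarith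
  with assms(3) have \<beta>: "\<beta> > -1" by (rule positive_weight_imp_parameter_gt)
  have "(product_term d \<sigma> \<beta> \<gamma> \<nu> \<mu> has_sum (if \<nu> = \<mu> then sq_norm d \<sigma> \<beta> \<gamma> \<nu> else 0)) (multi_indices d)"
  proof (cases "\<nu> = \<mu>")
    case True
    then show ?thesis using R_multi_square_has_sum[OF assms(2) \<beta> \<nu>(2)] by simp
  next
    case False
    then obtain i where "i \<in> {1..d}" "\<nu> i \<noteq> \<mu> i"
      using \<nu>(1) \<mu>(1) PiE_ext unfolding multi_indices_def by metis
    with False show ?thesis using R_multi_orthogonal[OF assms(2) \<beta> \<nu>(2) \<mu>(2)] by simp
  qed
  then show "((\<lambda>x. R_multi d \<sigma> \<beta> \<gamma> \<nu> (real_vec x) * R_multi d \<sigma> \<beta> \<gamma> \<mu> (real_vec x) * weight d \<sigma> \<beta> \<gamma> x)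
      has_sum (if \<nu> = \<mu> then sq_norm d \<sigma> \<beta> \<gamma> \<nu> else 0)) (multi_indices d)"
    unfolding product_term_def[abs_def] .
qed

end
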